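(* For any cardinals $\delta\le\kappa$ with $\delta$ regular and uncountable, if $\kappa$ is $(\delta,\kappa)$-compact, then $\kappa\ge\aleph_\delta$.
   Context: Work in ZFC. For an infinite cardinal $\delta$, $\mathcal L_{\delta,\omega}$ denotes the logic extending first-order logic by allowing conjunctions and disjunctions of arbitrary size less than $\delta$, with formulas using only finitely many free variables. A theory is ${<}\kappa$-satisfiable if every subset of it of size less than $\kappa$ has a model. For uncountable cardinals $\delta\le\kappa\le\lambda$ with $\delta$ regular, $\kappa$ is $(\delta,\lambda)$-compact if every ${<}\kappa$-satisfiable $\mathcal L_{\delta,\omega}$-theory in a language of size at most $\lambda$ is satisfiable (has a model). *)

theory Defs
  imports Main
begin

unbundle cardinal_syntax

section \<open>The logics \<open>L\<^bsub>\<delta>,\<omega>\<^esub>\<close>\<close>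

text \<open>
  Cardinals are represented by cardinal orders (\<^const>\<open>card_order_on\<close>) on an arbitrary carrier.
  One type \<^typ>\<open>'s\<close> supplies the names of function and relation symbols; constants are function
  symbols of arity 0.
\<close>

record 's language =
  funs :: "'s set"
  rels :: "'s set"
  farity :: "'s \<Rightarrow> nat"
  rarity :: "'s \<Rightarrow> nat"

definition symbols :: "('s, 'z) language_scheme \<Rightarrow> ('s + 's) set" where
  "symbols L = funs L <+> rels L"

datatype 's tm = Var nat | Fn 's "'s tm list"

text \<open>
  \<open>Conj I \<phi>\<close> and \<open>Disj I \<phi>\<close> stand for the conjunction and the disjunction of the family
  \<open>(\<phi> i)\<^bsub>i \<in> I\<^esub>\<close>; the values of \<open>\<phi>\<close> outside \<open>I\<close> are irrelevant. The type
  \<^typ>\<open>'d\<close> of indices will carry the cardinal \<open>\<delta>\<close>, so that every set of size less than \<open>\<delta>\<close>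
  can be indexed. Finite connectives are the case of a finite index set.
\<close>

datatype ('d, 's) fm =
    Eq "'s tm" "'s tm"
  | Rel 's "'s tm list"
  | Neg "('d, 's) fm"
  | Conj "'d set" "'d \<Rightarrow> ('d, 's) fm"
  | Disj "'d set" "'d \<Rightarrow> ('d, 's) fm"
  | Ex nat "('d, 's) fm"
  | All nat "('d, 's) fm"

primrec tm_vars :: "'s tm \<Rightarrow> nat set" where
  "tm_vars (Var x) = {x}"
| "tm_vars (Fn f ts) = \<Union> (set (map tm_vars ts))"

primrec free_vars :: "('d, 's) fm \<Rightarrow> nat set" where
  "free_vars (Eq s t) = tm_vars s \<union> tm_vars t"
| "free_vars (Rel r ts) = \<Union> (set (map tm_vars ts))"
| "free_vars (Neg \<phi>) = free_vars \<phi>"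
| "free_vars (Conj I \<phi>) = (\<Union>i\<in>I. free_vars (\<phi> i))"
| "free_vars (Disj I \<phi>) = (\<Union>i\<in>I. free_vars (\<phi> i))"
| "free_vars (Ex x \<phi>) = free_vars \<phi> - {x}"
| "free_vars (All x \<phi>) = free_vars \<phi> - {x}"

primrec is_term :: "('s, 'z) language_scheme \<Rightarrow> 's tm \<Rightarrow> bool" where
  "is_term L (Var x) \<longleftrightarrow> True"
| "is_term L (Fn f ts) \<longleftrightarrow> f \<in> funs L \<and> length ts = farity L f \<and> list_all (is_term L) ts"

text \<open>The formulas of \<open>L\<^bsub>\<delta>,\<omega>\<^esub>\<close> in the language \<open>L\<close>.\<close>

primrec is_formula :: "'d rel \<Rightarrow> ('s, 'z) language_scheme \<Rightarrow> ('d, 's) fm \<Rightarrow> bool" where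
  "is_formula \<delta> L (Eq s t) \<longleftrightarrow> is_term L s \<and> is_term L t"
| "is_formula \<delta> L (Rel r ts) \<longleftrightarrow>
     r \<in> rels L \<and> length ts = rarity L r \<and> list_all (is_term L) ts"
| "is_formula \<delta> L (Neg \<phi>) \<longleftrightarrow> is_formula \<delta> L \<phi>"
| "is_formula \<delta> L (Conj I \<phi>) \<longleftrightarrow>
     |I| <o \<delta> \<and> (\<forall>i\<in>I. is_formula \<delta> L (\<phi> i)) \<and> finite (\<Union>i\<in>I. free_vars (\<phi> i))"
| "is_formula \<delta> L (Disj I \<phi>) \<longleftrightarrow>
     |I| <o \<delta> \<and> (\<forall>i\<in>I. is_formula \<delta> L (\<phi> i)) \<and> finite (\<Union>i\<in>I. free_vars (\<phi> i))"
| "is_formula \<delta> L (Ex x \<phi>) \<longleftrightarrow> is_formula \<delta> L \<phi>"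
| "is_formula \<delta> L (All x \<phi>) \<longleftrightarrow> is_formula \<delta> L \<phi>"

definition sentences :: "'d rel \<Rightarrow> ('s, 'z) language_scheme \<Rightarrow> ('d, 's) fm set" where
  "sentences \<delta> L = {\<phi>. is_formula \<delta> L \<phi> \<and> free_vars \<phi> = {}}"

record ('s, 'm) struct =
  univ :: "'m set"
  fint :: "'s \<Rightarrow> 'm list \<Rightarrow> 'm"
  rint :: "'s \<Rightarrow> 'm list \<Rightarrow> bool"

definition is_structure :: "('s, 'z) language_scheme \<Rightarrow> ('s, 'm) struct \<Rightarrow> bool" where
  "is_structure L M \<longleftrightarrow> univ M \<noteq> {} \<and>
     (\<forall>f\<in>funs L. \<forall>as\<in>lists (univ M). length as = farity L f \<longrightarrow> fint M f as \<in> univ M)"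

primrec eval :: "('s, 'm) struct \<Rightarrow> (nat \<Rightarrow> 'm) \<Rightarrow> 's tm \<Rightarrow> 'm" where
  "eval M e (Var x) = e x"
| "eval M e (Fn f ts) = fint M f (map (eval M e) ts)"

primrec sat :: "('s, 'm) struct \<Rightarrow> ('d, 's) fm \<Rightarrow> (nat \<Rightarrow> 'm) \<Rightarrow> bool" where
  "sat M (Eq s t) = (\<lambda>e. eval M e s = eval M e t)"
| "sat M (Rel r ts) = (\<lambda>e. rint M r (map (eval M e) ts))"
| "sat M (Neg \<phi>) = (\<lambda>e. \<not> sat M \<phi> e)"
| "sat M (Conj I \<phi>) = (\<lambda>e. \<forall>i\<in>I. sat M (\<phi> i) e)"
| "sat M (Disj I \<phi>) = (\<lambda>e. \<exists>i\<in>I. sat M (\<phi> i) e)"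
| "sat M (Ex x \<phi>) = (\<lambda>e. \<exists>a\<in>univ M. sat M \<phi> (e(x := a)))"
| "sat M (All x \<phi>) = (\<lambda>e. \<forall>a\<in>univ M. sat M \<phi> (e(x := a)))"

definition is_model ::
  "('s, 'z) language_scheme \<Rightarrow> ('d, 's) fm set \<Rightarrow> ('s, 'm) struct \<Rightarrow> bool" where
  "is_model L T M \<longleftrightarrow> is_structure L M \<and>
     (\<forall>\<phi>\<in>T. \<forall>e. range e \<subseteq> univ M \<longrightarrow> sat M \<phi> e)"

text \<open>
  A definition cannot quantify over the type of elements of the model. The type \<^typ>\<open>'s set\<close> is
  large enough for this to be no restriction: by the theorem \<open>satisfiable_if_model\<close> below (downward
  Loewenheim-Skolem), a theory of \<open>L\<^bsub>\<delta>,\<omega>\<^esub>\<close> whose symbols are drawn from a type of size at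
  least \<open>\<delta>\<close> has a model with elements of any type whatsoever only if it has one of this type.
\<close>

definition satisfiable :: "('s, 'z) language_scheme \<Rightarrow> ('d, 's) fm set \<Rightarrow> bool" where
  "satisfiable L T \<longleftrightarrow> (\<exists>M :: ('s, 's set) struct. is_model L T M)"

definition lt_satisfiable ::
  "'k rel \<Rightarrow> ('s, 'z) language_scheme \<Rightarrow> ('d, 's) fm set \<Rightarrow> bool" where
  "lt_satisfiable \<kappa> L T \<longleftrightarrow> (\<forall>S. S \<subseteq> T \<and> |S| <o \<kappa> \<longrightarrow> satisfiable L S)"

text \<open>
  \<open>\<kappa>\<close> is \<open>(\<delta>,\<mu>)\<close>-compact. Up to renaming, the symbols of a language of size at most
  \<open>\<mu>\<close> can be taken from the carrier type of \<open>\<mu>\<close>.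
\<close>

definition compact_card :: "'d rel \<Rightarrow> 'k rel \<Rightarrow> 'l rel \<Rightarrow> bool" where
  "compact_card \<delta> \<kappa> \<mu> \<longleftrightarrow>
     (\<forall>(L :: 'l language) (T :: ('d, 'l) fm set).
        |symbols L| \<le>o \<mu> \<and> T \<subseteq> sentences \<delta> L \<and> lt_satisfiable \<kappa> L T \<longrightarrow> satisfiable L T)"


section \<open>Independence of the type of models\<close>

lemma card_lists_le:
  assumes inf: "infinite B" and le: "|A| \<le>o |B|"
  shows "|lists A| \<le>o |B|"
proof -
  have fixed: "|{xs \<in> lists A. length xs = n}| \<le>o |B|" for n
  proof (induction n)
    case 0
    have "{xs \<in> lists A. length xs = 0} \<subseteq> {[]}" by auto
    then have "finite {xs \<in> lists A. length xs = 0}" by (rule finite_subset) simp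
    then show ?case
      by (metis inf card_of_Well_order card_of_ordLeq_finite ordLeq_total)
  next
    case (Suc n)
    let ?P = "{xs \<in> lists A. length xs = n}"
    have sub: "{xs \<in> lists A. length xs = Suc n} \<subseteq> (\<lambda>(x, xs). x # xs) ` (A \<times> ?P)"
      by (auto simp: length_Suc_conv)
    have "|A \<times> ?P| \<le>o |B|"
      using card_of_Sigma_ordLeq_infinite[OF inf le, of "\<lambda>_. ?P"] Suc by simp
    then show ?case
      by (rule ordLeq_transitive[OF card_of_mono1[OF sub] ordLeq_transitive[OF card_of_image]])
  qed
  have eq: "lists A = (\<Union>n\<in>UNIV. {xs \<in> lists A. length xs = n})" by auto
  have "|UNIV :: nat set| \<le>o |B|"
    using inf by (rule infinite_iff_card_of_nat[THEN iffD1])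
  then have "|\<Union>n\<in>UNIV. {xs \<in> lists A. length xs = n}| \<le>o |B|"
    by (rule card_of_UNION_ordLeq_infinite[OF inf]) (simp add: fixed)
  then show ?thesis using eq by simp
qed

lemma card_image_le:
  assumes "|A| \<le>o |B|" shows "|f ` A| \<le>o |B|"
  using assms card_of_image ordLeq_transitive by blast

lemma card_Times_le:
  assumes "infinite B" "|A| \<le>o |B|" "|C| \<le>o |B|" shows "|A \<times> C| \<le>o |B|"
  using card_of_Sigma_ordLeq_infinite[OF assms(1,2), of "\<lambda>_. C"] assms(3) by simp

lemma card_Un_le:
  assumes "infinite B" "|A| \<le>o |B|" "|C| \<le>o |B|" shows "|A \<union> C| \<le>o |B|"
  using assms by (intro card_of_Un_ordLeq_infinite_Field) (auto simp: Field_card_of card_of_card_order_on)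

lemma card_nat_UN_le:
  assumes "infinite B" "\<And>n :: nat. |A n| \<le>o |B|" shows "|\<Union>n. A n| \<le>o |B|"
  using infinite_iff_card_of_nat[THEN iffD1, OF assms(1)] assms(2)
  by (intro card_of_UNION_ordLeq_infinite[OF assms(1)]) auto

lemma card_nat_le: "infinite B \<Longrightarrow> |A :: nat set| \<le>o |B|"
  using infinite_iff_card_of_nat[of B] card_of_mono1[of A UNIV] ordLeq_transitive by blast

lemma card_tm_le:
  assumes inf: "infinite (UNIV :: 's set)"
  shows "|UNIV :: 's tm set| \<le>o |UNIV :: 's set|"
proof -
  have lev: "|{t :: 's tm. size t < n}| \<le>o |UNIV :: 's set|" for n
  proof (induction n)
    case 0
    then show ?case by (simp add: card_of_empty)
  next
    case (Suc n)
    let ?P = "{t :: 's tm. size t < n}"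
    have sub: "{t :: 's tm. size t < Suc n} \<subseteq>
        Var ` UNIV \<union> (\<lambda>(f, ts). Fn f ts) ` (UNIV \<times> lists ?P)"
    proof
      fix t :: "'s tm" assume t: "t \<in> {t. size t < Suc n}"
      show "t \<in> Var ` UNIV \<union> (\<lambda>(f, ts). Fn f ts) ` (UNIV \<times> lists ?P)"
      proof (cases t)
        case (Fn f ts)
        have "size u < n" if "u \<in> set ts" for u
        proof -
          have "size u \<le> size_list size ts"
            using that by (simp add: size_list_estimation')
          then show ?thesis using t Fn by simp
        qed
        then show ?thesis using Fn by force
      qed auto
    qed
    have "|Var ` UNIV \<union> (\<lambda>(f, ts). Fn f ts) ` (UNIV \<times> lists ?P)| \<le>o |UNIV :: 's set|"
      by (intro card_Un_le[OF inf] card_image_le card_Times_le[OF inf] card_lists_le[OF inf]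
          card_nat_le[OF inf] Suc card_of_mono1) simp
    then show ?case using card_of_mono1[OF sub] ordLeq_transitive by blast
  qed
  have "(UNIV :: 's tm set) = (\<Union>n. {t. size t < n})" by auto
  then show ?thesis using card_nat_UN_le[OF inf, of "\<lambda>n. {t :: 's tm. size t < n}"] lev by simp
qed

datatype 's lab =
  LIdx 's | LEq "'s tm" "'s tm" | LRel 's "'s tm list" | LNeg | LConj | LDisj | LEx nat | LAll nat

lemma card_lab_le:
  assumes inf: "infinite (UNIV :: 's set)"
  shows "|UNIV :: 's lab set| \<le>o |UNIV :: 's set|"
proof -
  have "(UNIV :: 's lab set) = LIdx ` UNIV \<union> ((\<lambda>(s, t). LEq s t) ` (UNIV \<times> UNIV) \<union>
     ((\<lambda>(r, ts). LRel r ts) ` (UNIV \<times> lists UNIV) \<union>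
     ((\<lambda>n :: nat. if n = 0 then LNeg else if n = 1 then LConj else LDisj) ` UNIV \<union>
     (LEx ` UNIV \<union> LAll ` UNIV))))" (is "_ = ?R")
  proof -
    have "x \<in> ?R" for x :: "'s lab"
    proof (cases x)
      case LNeg then show ?thesis by (auto intro!: image_eqI[where x=0])
    next
      case LConj then show ?thesis by (auto intro!: image_eqI[where x=1])
    next
      case LDisj then show ?thesis by (auto intro!: image_eqI[where x=2])
    next
      case (LEq s t) then show ?thesis by (auto intro!: image_eqI[where x="(s,t)"])
    next
      case (LRel s t) then show ?thesis by (auto intro!: image_eqI[where x="(s,t)"])
    qed auto
    then show ?thesis by blast
  qed
  moreover have "|?R| \<le>o |UNIV :: 's set|"
    by (intro card_Un_le[OF inf] card_image_le card_Times_le[OF inf] card_lists_le[OF inf]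
        card_tm_le[OF inf] card_nat_le[OF inf] card_of_mono1) simp_all
  ultimately show ?thesis by simp
qed

primrec enc :: "('d set \<Rightarrow> 'd \<Rightarrow> 's) \<Rightarrow> ('d, 's) fm \<Rightarrow> 's lab list set" where
  "enc g (Eq s t) = {[LEq s t]}"
| "enc g (Rel r ts) = {[LRel r ts]}"
| "enc g (Neg \<phi>) = (#) LNeg ` enc g \<phi>"
| "enc g (Conj I \<phi>) = insert [LConj] (\<Union>i\<in>I. (#) (LIdx (g I i)) ` enc g (\<phi> i))"
| "enc g (Disj I \<phi>) = insert [LDisj] (\<Union>i\<in>I. (#) (LIdx (g I i)) ` enc g (\<phi> i))"
| "enc g (Ex x \<phi>) = (#) (LEx x) ` enc g \<phi>"
| "enc g (All x \<phi>) = (#) (LAll x) ` enc g \<phi>"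

lemma enc_nonempty: "enc g \<phi> \<noteq> {}"
  by (induction \<phi>) auto

lemma Cons_image_eq_iff:
  "(#) l ` A = (#) l' ` B \<longleftrightarrow> A = {} \<and> B = {} \<or> l = l' \<and> A = B"
  by auto

lemma enc_ne_Nil: "[] \<notin> enc g \<phi>"
  by (cases \<phi>) auto

definition pre :: "'s lab \<Rightarrow> 's lab list set \<Rightarrow> 's lab list set" where
  "pre l P = {p. l # p \<in> P}"

lemma pre_simps:
  "l \<noteq> l' \<Longrightarrow> pre l ((#) l' ` P) = {}"
  "pre l ((#) l ` P) = P"
  by (auto simp: pre_def)

lemma pre_idx:
  assumes "inj_on (g I) I" "i \<in> I"
  shows "pre (LIdx (g I i)) (enc g (Conj I \<phi>)) = enc g (\<phi> i)"
    and "pre (LIdx (g I i)) (enc g (Disj I \<phi>)) = enc g (\<phi> i)"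
  using assms by (auto simp: pre_def dest: inj_onD)

lemma pre_idx_nonempty:
  assumes "pre (LIdx a) (enc g (Conj I \<phi>)) \<noteq> {} \<or> pre (LIdx a) (enc g (Disj I \<phi>)) \<noteq> {}"
  shows "\<exists>i\<in>I. a = g I i"
  using assms by (auto simp: pre_def)

lemma match_idx:
  assumes "inj_on (g I) I" "inj_on (g J) J"
    and "enc g (Conj I \<phi>) = enc g (Conj J \<psi>) \<or> enc g (Disj I \<phi>) = enc g (Disj J \<psi>)"
    and "i \<in> I"
  shows "\<exists>j\<in>J. enc g (\<phi> i) = enc g (\<psi> j)"
proof -
  have "pre (LIdx (g I i)) (enc g (Conj J \<psi>)) = enc g (\<phi> i) \<or>
      pre (LIdx (g I i)) (enc g (Disj J \<psi>)) = enc g (\<phi> i)"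
    using pre_idx[of g I i \<phi>] assms by metis
  moreover from this obtain j where "j \<in> J" "g I i = g J j"
    using pre_idx_nonempty[of "g I i" g J \<psi>] enc_nonempty by metis
  ultimately show ?thesis using pre_idx[of g J j \<psi>] assms(2) by metis
qed

lemma enc_imp_sat_eq:
  assumes inj: "\<And>I :: 'd set. |I| <o \<delta> \<Longrightarrow> inj_on (g I) I"
  shows "is_formula \<delta> L \<phi> \<Longrightarrow> is_formula \<delta> L \<psi> \<Longrightarrow> enc g \<phi> = enc g \<psi> \<Longrightarrow>
     sat M \<phi> = sat M \<psi>"
proof (induction \<phi> arbitrary: \<psi>)
  case (Conj I \<phi>)
  have "[LConj] \<in> enc g \<psi>" unfolding Conj.prems(3)[symmetric] by simp
  then obtain J \<phi>' where psi: "\<psi> = fm.Conj J \<phi>'"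
    by (cases \<psi>) (simp_all add: image_iff enc_nonempty enc_ne_Nil)
  have inj: "inj_on (g I) I" "inj_on (g J) J" using Conj.prems psi inj by auto
  have I: "\<exists>j\<in>J. sat M (\<phi> i) = sat M (\<phi>' j)" if ij: "i \<in> I" for i
  proof -
    obtain j where "j \<in> J" "enc g (\<phi> i) = enc g (\<phi>' j)"
      using match_idx[OF inj _ ij] Conj.prems(3) psi by blast
    moreover from this have "sat M (\<phi> i) = sat M (\<phi>' j)"
      using Conj.prems(1,2) ij psi by (intro Conj.IH[OF rangeI]) auto
    ultimately show ?thesis by blast
  qed
  have J: "\<exists>i\<in>I. sat M (\<phi> i) = sat M (\<phi>' j)" if ij: "j \<in> J" for j
  proof -
    obtain i where "i \<in> I" "enc g (\<phi> i) = enc g (\<phi>' j)"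
      using match_idx[OF inj(2,1) _ ij] Conj.prems(3) psi by metis
    moreover from this have "sat M (\<phi> i) = sat M (\<phi>' j)"
      using Conj.prems(1,2) ij psi by (intro Conj.IH[OF rangeI]) auto
    ultimately show ?thesis by blast
  qed
  show ?case unfolding psi sat.simps using I J by metis
next
  case (Disj I \<phi>)
  have "[LDisj] \<in> enc g \<psi>" unfolding Disj.prems(3)[symmetric] by simp
  then obtain J \<phi>' where psi: "\<psi> = fm.Disj J \<phi>'"
    by (cases \<psi>) (simp_all add: image_iff enc_nonempty enc_ne_Nil)
  have inj: "inj_on (g I) I" "inj_on (g J) J" using Disj.prems psi inj by auto
  have I: "\<exists>j\<in>J. sat M (\<phi> i) = sat M (\<phi>' j)" if ij: "i \<in> I" for i
  proof -
    obtain j where "j \<in> J" "enc g (\<phi> i) = enc g (\<phi>' j)"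
      using match_idx[OF inj _ ij] Disj.prems(3) psi by blast
    moreover from this have "sat M (\<phi> i) = sat M (\<phi>' j)"
      using Disj.prems(1,2) ij psi by (intro Disj.IH[OF rangeI]) auto
    ultimately show ?thesis by blast
  qed
  have J: "\<exists>i\<in>I. sat M (\<phi> i) = sat M (\<phi>' j)" if ij: "j \<in> J" for j
  proof -
    obtain i where "i \<in> I" "enc g (\<phi> i) = enc g (\<phi>' j)"
      using match_idx[OF inj(2,1) _ ij] Disj.prems(3) psi by metis
    moreover from this have "sat M (\<phi> i) = sat M (\<phi>' j)"
      using Disj.prems(1,2) ij psi by (intro Disj.IH[OF rangeI]) auto
    ultimately show ?thesis by blast
  qed
  show ?case unfolding psi sat.simps using I J by metis
next
  case (Eq s t) then show ?case by (cases \<psi>) auto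
next
  case (Rel r ts) then show ?case by (cases \<psi>) auto
next
  case (Neg \<phi>)
  obtain \<phi>' where psi: "\<psi> = fm.Neg \<phi>'"
    using Neg.prems by (cases \<psi>) (auto simp: Cons_image_eq_iff enc_nonempty)
  have "enc g \<phi> = enc g \<phi>'"
    using Neg.prems psi by (simp add: Cons_image_eq_iff enc_nonempty)
  then have "sat M \<phi> = sat M \<phi>'" using Neg.prems psi by (intro Neg.IH) auto
  then show ?case using psi by simp
next
  case (Ex x \<phi>)
  obtain \<phi>' where psi: "\<psi> = fm.Ex x \<phi>'"
    using Ex.prems by (cases \<psi>) (auto simp: Cons_image_eq_iff enc_nonempty)
  have "enc g \<phi> = enc g \<phi>'"
    using Ex.prems psi by (simp add: Cons_image_eq_iff enc_nonempty)
  then have "sat M \<phi> = sat M \<phi>'" using Ex.prems psi by (intro Ex.IH) auto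
  then show ?case using psi by simp
next
  case (All x \<phi>)
  obtain \<phi>' where psi: "\<psi> = fm.All x \<phi>'"
    using All.prems by (cases \<psi>) (auto simp: Cons_image_eq_iff enc_nonempty)
  have "enc g \<phi> = enc g \<phi>'"
    using All.prems psi by (simp add: Cons_image_eq_iff enc_nonempty)
  then have "sat M \<phi> = sat M \<phi>'" using All.prems psi by (intro All.IH) auto
  then show ?case using psi by simp
qed

lemma card_sat_le:
  fixes \<delta> :: "'d rel" and L :: "('s, 'z) language_scheme" and M :: "('s, 'm) struct"
  assumes inf: "infinite (UNIV :: 's set)" and le: "\<delta> \<le>o |UNIV :: 's set|"
  shows "|sat M ` {\<phi>. is_formula \<delta> L \<phi>}| \<le>o |UNIV :: 's set set|"
proof -
  define g :: "'d set \<Rightarrow> 'd \<Rightarrow> 's" where "g I = (SOME f. inj_on f I)" for I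
  have inj: "inj_on (g I) I" if "|I| <o \<delta>" for I
  proof -
    have "|I| \<le>o |UNIV :: 's set|" using that le ordLess_ordLeq_trans ordLess_imp_ordLeq by blast
    then have "\<exists>f :: 'd \<Rightarrow> 's. inj_on f I" using card_of_ordLeq[of I "UNIV :: 's set"] by auto
    then show ?thesis unfolding g_def by (rule someI_ex)
  qed
  let ?F = "{\<phi>. is_formula \<delta> L \<phi>}"
  have "sat M ` ?F = (\<lambda>c. sat M (SOME \<phi>. is_formula \<delta> L \<phi> \<and> enc g \<phi> = c)) ` (enc g ` ?F)"
  proof -
    have "sat M \<phi> = sat M (SOME \<phi>'. is_formula \<delta> L \<phi>' \<and> enc g \<phi>' = enc g \<phi>)"
      if "is_formula \<delta> L \<phi>" for \<phi>
      using someI[of "\<lambda>\<phi>'. is_formula \<delta> L \<phi>' \<and> enc g \<phi>' = enc g \<phi>" \<phi>] that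
      by (intro enc_imp_sat_eq[OF inj, where L=L]) auto
    then show ?thesis unfolding image_image by (intro image_cong) auto
  qed
  moreover have "|UNIV :: 's lab list set set| \<le>o |UNIV :: 's set set|"
  proof -
    have "|UNIV :: 's lab list set| \<le>o |UNIV :: 's set|"
      using card_lists_le[OF inf card_lab_le[OF inf]] by simp
    then obtain f :: "'s lab list \<Rightarrow> 's" where "inj f" using card_of_ordLeq[of UNIV UNIV] by auto
    then have "inj ((`) f)" by (simp add: inj_def inj_image_eq_iff)
    then show ?thesis using card_of_ordLeq[of UNIV UNIV] by blast
  qed
  then have "|enc g ` ?F| \<le>o |UNIV :: 's set set|"
    using card_of_mono1[of "enc g ` ?F" UNIV] ordLeq_transitive by blast
  ultimately show ?thesis using card_image_le by auto
qed

lemma finite_tm_vars: "finite (tm_vars t)"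
  by (induction t) auto

lemma finite_free_vars: "is_formula \<delta> L \<phi> \<Longrightarrow> finite (free_vars \<phi>)"
  by (induction \<phi>) (auto simp: finite_tm_vars)

lemma eval_cong: "(\<And>x. x \<in> tm_vars t \<Longrightarrow> e x = e' x) \<Longrightarrow> eval M e t = eval M e' t"
proof (induction t)
  case (Fn f ts)
  then have "map (eval M e) ts = map (eval M e') ts" by auto
  then show ?case by (simp del: map_eq_conv)
qed auto

lemma sat_cong:
  fixes e e' :: "nat \<Rightarrow> 'm"
  shows "(\<And>x. x \<in> free_vars \<phi> \<Longrightarrow> e x = e' x) \<Longrightarrow> sat M \<phi> e = sat M \<phi> e'"
proof (induction \<phi> arbitrary: e e')
  case (Eq s t)
  then show ?case using eval_cong[where t=s] eval_cong[where t=t] by (metis UnCI free_vars.simps(1) sat.simps(1))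
next
  case (Rel r ts)
  then have "map (eval M e) ts = map (eval M e') ts" by (auto intro: eval_cong)
  then show ?case by (simp del: map_eq_conv)
next
  case (Neg \<phi>)
  show ?case using Neg.IH[of e e'] Neg.prems by simp
next
  case (Conj I \<phi>)
  have "sat M (\<phi> i) e = sat M (\<phi> i) e'" if "i \<in> I" for i
    using Conj.IH[OF rangeI[of \<phi> i], of e e'] Conj.prems that by auto
  then show ?case by simp
next
  case (Disj I \<phi>)
  have "sat M (\<phi> i) e = sat M (\<phi> i) e'" if "i \<in> I" for i
    using Disj.IH[OF rangeI[of \<phi> i], of e e'] Disj.prems that by auto
  then show ?case by simp
next
  case (Ex x \<phi>)
  have "sat M \<phi> (e(x := a)) = sat M \<phi> (e'(x := a))" for a
    by (rule Ex.IH) (use Ex.prems in auto)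
  then show ?case by simp
next
  case (All x \<phi>)
  have "sat M \<phi> (e(x := a)) = sat M \<phi> (e'(x := a))" for a
    by (rule All.IH) (use All.prems in auto)
  then show ?case by simp
qed

definition env_of :: "'m list \<Rightarrow> nat \<Rightarrow> 'm" where
  "env_of as n = (if n < length as then as ! n else as ! 0)"

primrec skolem_stage :: "('s, 'z) language_scheme \<Rightarrow> ('s, 'm) struct \<Rightarrow> ((nat \<Rightarrow> 'm) \<Rightarrow> bool) set \<Rightarrow> 'm \<Rightarrow>
    nat \<Rightarrow> 'm set" where
  "skolem_stage L M Q a0 0 = {a0}"
| "skolem_stage L M Q a0 (Suc n) = skolem_stage L M Q a0 n \<union>
     ((\<lambda>(f, as). fint M f as) `
        (SIGMA f : funs L. {as \<in> lists (skolem_stage L M Q a0 n). length as = farity L f}) \<union>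
      (\<lambda>(q, x, as). if \<exists>a\<in>univ M. q ((env_of as)(x := a))
                    then SOME a. a \<in> univ M \<and> q ((env_of as)(x := a)) else a0) `
        (Q \<times> UNIV \<times> lists (skolem_stage L M Q a0 n)))"

lemma lists_UN_mono:
  fixes A :: "nat \<Rightarrow> 'a set"
  assumes "mono A" "as \<in> lists (\<Union>n. A n)"
  shows "\<exists>n. as \<in> lists (A n)"
  using assms(2)
proof (induction as)
  case (Cons a as)
  then obtain n m where "as \<in> lists (A n)" "a \<in> A m" by auto
  then have "a # as \<in> lists (A (max n m))"
    using monoD[OF assms(1), of n "max n m"] monoD[OF assms(1), of m "max n m"] by auto
  then show ?case by blast
qed simp

lemma skolem_hull:
  fixes M :: "('s, 'm) struct" and \<delta> :: "'d rel"
  assumes inf: "infinite (UNIV :: 's set)" and le: "\<delta> \<le>o |UNIV :: 's set|"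
    and M: "is_structure L M"
  obtains H where "H \<subseteq> univ M" "H \<noteq> {}" "|H| \<le>o |UNIV :: 's set set|"
    "\<And>f as. f \<in> funs L \<Longrightarrow> as \<in> lists H \<Longrightarrow> length as = farity L f \<Longrightarrow> fint M f as \<in> H"
    "\<And>\<phi> x e. is_formula \<delta> L \<phi> \<Longrightarrow> range e \<subseteq> H \<Longrightarrow> \<exists>a\<in>univ M. sat M \<phi> (e(x := a)) \<Longrightarrow>
       \<exists>a\<in>H. sat M \<phi> (e(x := a))"
proof -
  obtain a0 where a0: "a0 \<in> univ M" using M by (auto simp: is_structure_def)
  define Q where "Q = sat M ` {\<phi>. is_formula \<delta> L \<phi>}"
  define A where "A = skolem_stage L M Q a0"
  define H where "H = (\<Union>n. A n)"
  have mono: "mono A" unfolding A_def by (intro mono_iff_le_Suc[THEN iffD2]) auto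
  have infP: "infinite (UNIV :: 's set set)"
    using inf by (simp add: Finite_Set.finite_set)
  have leP: "|UNIV :: 's set| \<le>o |UNIV :: 's set set|"
    using card_of_Pow[of "UNIV :: 's set"] ordLess_imp_ordLeq by simp
  have Q: "|Q| \<le>o |UNIV :: 's set set|" unfolding Q_def by (rule card_sat_le[OF inf le])
  have AM: "A n \<subseteq> univ M" for n
  proof (induction n)
    case 0 then show ?case using a0 by (simp add: A_def)
  next
    case (Suc n)
    then have "lists (A n) \<subseteq> lists (univ M)" by (rule lists_mono)
    then have 1: "fint M f as \<in> univ M"
      if "f \<in> funs L" "as \<in> lists (A n)" "length as = farity L f" for f as
      using M that unfolding is_structure_def by blast
    have 2: "(if \<exists>a\<in>univ M. P a then SOME a. a \<in> univ M \<and> P a else a0) \<in> univ M" for P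
      using a0 someI_ex[of "\<lambda>a. a \<in> univ M \<and> P a"] by auto
    show ?case using Suc 1 2 unfolding A_def by (auto simp del: lists_eq_set)
  qed
  have cA: "|A n| \<le>o |UNIV :: 's set set|" for n
  proof (induction n)
    case 0
    then show ?case using card_of_singl_ordLeq[of "UNIV :: 's set set" a0] by (simp add: A_def)
  next
    case (Suc n)
    have "|SIGMA f : funs L. {as \<in> lists (A n). length as = farity L f}| \<le>o |UNIV :: 's set set|"
    proof (rule card_of_Sigma_ordLeq_infinite[OF infP])
      show "|funs L| \<le>o |UNIV :: 's set set|"
        using card_of_mono1[of "funs L" UNIV] leP ordLeq_transitive by blast
      show "\<forall>f\<in>funs L. |{as \<in> lists (A n). length as = farity L f}| \<le>o |UNIV :: 's set set|"
        by (auto simp del: lists_eq_set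
            intro!: ordLeq_transitive[OF card_of_mono1 card_lists_le[OF infP Suc]])
    qed
    then have "|A (Suc n)| \<le>o |UNIV :: 's set set|"
      unfolding A_def skolem_stage.simps unfolding A_def[symmetric]
      by (intro card_Un_le[OF infP] card_image_le card_Times_le[OF infP] card_lists_le[OF infP]
          card_nat_le[OF infP] Suc Q)
    then show ?case .
  qed
  have 1: "H \<subseteq> univ M" using AM by (auto simp: H_def)
  have "a0 \<in> A 0" by (simp add: A_def)
  then have 2: "H \<noteq> {}" unfolding H_def by blast
  have 3: "|H| \<le>o |UNIV :: 's set set|" unfolding H_def by (rule card_nat_UN_le[OF infP cA])
  have 4: "fint M f as \<in> H" if "f \<in> funs L" "as \<in> lists H" "length as = farity L f" for f as
  proof -
    from that(2) obtain n where "as \<in> lists (A n)"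
      unfolding H_def using lists_UN_mono[OF mono] by blast
    then have "fint M f as \<in> A (Suc n)"
      using that unfolding A_def by (force simp del: lists_eq_set)
    then show ?thesis unfolding H_def by blast
  qed
  have 5: "\<exists>a\<in>H. sat M \<phi> (e(x := a))"
    if \<phi>: "is_formula \<delta> L \<phi>" and e: "range e \<subseteq> H" and ex: "\<exists>a\<in>univ M. sat M \<phi> (e(x := a))"
    for \<phi> x e
  proof -
    obtain m where m: "\<And>y. y \<in> free_vars \<phi> \<Longrightarrow> y < m"
      using finite_nat_set_iff_bounded[THEN iffD1, OF finite_free_vars[OF \<phi>]] by auto
    define as where "as = map e [0..<Suc m]"
    have agree: "sat M \<phi> (e(x := a)) = sat M \<phi> ((env_of as)(x := a))" for a
    proof (rule sat_cong)
      fix y assume "y \<in> free_vars \<phi>"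
      then have "y < Suc m" using m less_SucI by blast
      then show "(e(x := a)) y = ((env_of as)(x := a)) y"
        unfolding env_of_def as_def by (simp del: upt_Suc)
    qed
    have "as \<in> lists H" unfolding as_def using range_subsetD[OF e] by auto
    then obtain n where n: "as \<in> lists (A n)"
      unfolding H_def using lists_UN_mono[OF mono] by blast
    let ?w = "\<lambda>(q, x, as). if \<exists>a\<in>univ M. q ((env_of as)(x := a))
                  then SOME a. a \<in> univ M \<and> q ((env_of as)(x := a)) else a0"
    have "?w (sat M \<phi>, x, as) \<in> ?w ` (Q \<times> UNIV \<times> lists (A n))"
      using n \<phi> by (intro imageI) (auto simp: Q_def)
    then have "?w (sat M \<phi>, x, as) \<in> A (Suc n)" unfolding A_def skolem_stage.simps by blast
    then have "?w (sat M \<phi>, x, as) \<in> H" unfolding H_def by blast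
    moreover have "sat M \<phi> ((env_of as)(x := ?w (sat M \<phi>, x, as)))"
      using ex agree someI_ex[of "\<lambda>a. a \<in> univ M \<and> sat M \<phi> ((env_of as)(x := a))"] by auto
    ultimately show ?thesis using agree by blast
  qed
  show ?thesis using 1 2 3 4 5 by (rule that)
qed

theorem satisfiable_if_model:
  fixes \<delta> :: "'d rel" and L :: "('s, 'z) language_scheme"
  assumes inf: "infinite (UNIV :: 's set)" and le: "\<delta> \<le>o |UNIV :: 's set|"
    and T: "T \<subseteq> sentences \<delta> L" and model: "is_model L T (M :: ('s, 'm) struct)"
  shows "satisfiable L T"
proof -
  have M: "is_structure L M" using model by (simp add: is_model_def)
  obtain H where H: "H \<subseteq> univ M" "H \<noteq> {}" "|H| \<le>o |UNIV :: 's set set|"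
    and fH: "\<And>f as. f \<in> funs L \<Longrightarrow> as \<in> lists H \<Longrightarrow> length as = farity L f \<Longrightarrow> fint M f as \<in> H"
    and wit: "\<And>\<phi> x e. is_formula \<delta> L \<phi> \<Longrightarrow> range e \<subseteq> H \<Longrightarrow>
       \<exists>a\<in>univ M. sat M \<phi> (e(x := a)) \<Longrightarrow> \<exists>a\<in>H. sat M \<phi> (e(x := a))"
    using skolem_hull[OF inf le M] by metis
  obtain h :: "'m \<Rightarrow> 's set" where h: "inj_on h H"
    using H(3) card_of_ordLeq[of H UNIV] by auto
  define k where "k = inv_into H h"
  have k: "k (h a) = a" if "a \<in> H" for a using h that by (simp add: k_def)
  have mapk: "map k (map h as) = as" if "set as \<subseteq> H" for as
    using that k by (induction as) auto
  define N :: "('s, 's set) struct" where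
    "N = \<lparr>univ = h ` H, fint = \<lambda>f bs. h (fint M f (map k bs)), rint = \<lambda>r bs. rint M r (map k bs)\<rparr>"
  have ev: "is_term L t \<Longrightarrow> eval M e t \<in> H \<and> eval N (\<lambda>x. h (e x)) t = h (eval M e t)"
    if e: "range e \<subseteq> H" for e t
  proof (induction t)
    case (Var x) then show ?case using e by auto
  next
    case (Fn f ts)
    then have ts: "set (map (eval M e) ts) \<subseteq> H" by (auto simp: list_all_iff)
    have "map (eval N (\<lambda>x. h (e x))) ts = map h (map (eval M e) ts)"
      using Fn by (auto simp: list_all_iff)
    then have "map k (map (eval N (\<lambda>x. h (e x))) ts) = map (eval M e) ts"
      using mapk[OF ts] by simp
    then have "eval N (\<lambda>x. h (e x)) (Fn f ts) = h (eval M e (Fn f ts))"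
      by (simp add: N_def del: map_map)
    moreover have "eval M e (Fn f ts) \<in> H" using Fn.prems ts fH[of f "map (eval M e) ts"]
      by (simp add: in_listsI subset_eq)
    ultimately show ?case by blast
  qed
  have elem: "is_formula \<delta> L \<phi> \<Longrightarrow> range e \<subseteq> H \<Longrightarrow> sat N \<phi> (\<lambda>x. h (e x)) = sat M \<phi> e" for \<phi> e
  proof (induction \<phi> arbitrary: e)
    case (Eq s t)
    then show ?case using ev[OF Eq.prems(2), of s] ev[OF Eq.prems(2), of t] h
      by (auto dest: inj_onD)
  next
    case (Rel r ts)
    have ts: "set (map (eval M e) ts) \<subseteq> H" using Rel ev by (auto simp: list_all_iff)
    have "map (eval N (\<lambda>x. h (e x))) ts = map h (map (eval M e) ts)"
      using Rel ev by (auto simp: list_all_iff)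
    then have "map k (map (eval N (\<lambda>x. h (e x))) ts) = map (eval M e) ts"
      using mapk[OF ts] by simp
    then show ?case by (simp add: N_def del: map_map)
  next
    case (Neg \<phi>)
    then show ?case by simp
  next
    case (Conj I \<phi>)
    then show ?case by auto
  next
    case (Disj I \<phi>)
    then show ?case by auto
  next
    case (Ex x \<phi>)
    have upd: "sat N \<phi> ((\<lambda>y. h (e y))(x := h a)) = sat M \<phi> (e(x := a))" if "a \<in> H" for a
    proof -
      have upd: "(\<lambda>y. h (e y))(x := h a) = (\<lambda>y. h ((e(x := a)) y))" by (rule ext) simp
      have "is_formula \<delta> L \<phi>" "range (e(x := a)) \<subseteq> H" using Ex.prems that by auto
      then show ?thesis unfolding upd by (rule Ex.IH)
    qed
    have "sat N (fm.Ex x \<phi>) (\<lambda>x. h (e x)) = (\<exists>a\<in>H. sat M \<phi> (e(x := a)))"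
      using upd by (simp add: N_def)
    then show ?case using wit[of \<phi> e x] Ex.prems H(1) by auto
  next
    case (All x \<phi>)
    have upd: "sat N \<phi> ((\<lambda>y. h (e y))(x := h a)) = sat M \<phi> (e(x := a))" if "a \<in> H" for a
    proof -
      have upd: "(\<lambda>y. h (e y))(x := h a) = (\<lambda>y. h ((e(x := a)) y))" by (rule ext) simp
      have "is_formula \<delta> L \<phi>" "range (e(x := a)) \<subseteq> H" using All.prems that by auto
      then show ?thesis unfolding upd by (rule All.IH)
    qed
    have "sat N (fm.All x \<phi>) (\<lambda>x. h (e x)) = (\<forall>a\<in>H. sat M \<phi> (e(x := a)))"
      using upd by (simp add: N_def)
    then show ?case using wit[of "fm.Neg \<phi>" e x] All.prems H(1) by auto
  qed
  have "is_structure L N"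
    unfolding is_structure_def
  proof (intro conjI ballI impI)
    show "univ N \<noteq> {}" using H by (simp add: N_def)
    fix f bs assume f: "f \<in> funs L" "bs \<in> lists (univ N)" "length bs = farity L f"
    then have "map k bs \<in> lists H" using k by (force simp: N_def)
    then show "fint N f bs \<in> univ N" using f fH by (simp add: N_def del: lists_eq_set)
  qed
  moreover have "sat N \<phi> e" if "\<phi> \<in> T" "range e \<subseteq> univ N" for \<phi> e
  proof -
    have hk: "k b \<in> H \<and> h (k b) = b" if "b \<in> univ N" for b
      using that k by (auto simp: N_def)
    have e: "e x \<in> univ N" for x using that(2) by auto
    have kH: "range (\<lambda>x. k (e x)) \<subseteq> H" using hk e by blast
    have "is_formula \<delta> L \<phi>" using that(1) T by (auto simp: sentences_def)
    then have "sat N \<phi> (\<lambda>x. h (k (e x))) = sat M \<phi> (\<lambda>x. k (e x))" by (rule elem[OF _ kH])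
    moreover have "sat M \<phi> (\<lambda>x. k (e x))"
      using model that(1) order_trans[OF kH H(1)] unfolding is_model_def by blast
    ultimately show ?thesis using hk e by simp
  qed
  ultimately show ?thesis unfolding satisfiable_def is_model_def by blast
qed


section \<open>Alephs\<close>

text \<open>
  An element \<open>x\<close> of a cardinal order \<open>c\<close> represents the ordinal \<^term>\<open>Restr c (underS c x)\<close>
  below \<open>c\<close>. So \<open>infinite_cards_below c\<close> represents the infinite cardinals less than \<open>c\<close>.
\<close>

definition infinite_cards_below :: "'k rel \<Rightarrow> 'k set" where
  "infinite_cards_below c =
     {x \<in> Field c. infinite (underS c x) \<and> card_order_on (underS c x) (Restr c (underS c x))}"

text \<open>
  For a well-order \<open>r\<close>, viewed as the ordinal \<open>\<alpha>\<close>, the following says that \<open>c\<close> is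
  \<open>\<aleph>\<^bsub>\<alpha>\<^esub>\<close>, the \<open>\<alpha>\<close>-th infinite cardinal: the infinite cardinals below \<open>c\<close> have order
  type \<open>\<alpha>\<close>.
\<close>

definition is_aleph :: "'a rel \<Rightarrow> 'k rel \<Rightarrow> bool" where
  "is_aleph r c \<longleftrightarrow> Card_order c \<and> infinite (Field c) \<and> Restr c (infinite_cards_below c) =o r"

end

theory Submission
  imports Defs
begin

text \<open>
  Suppose that fewer than \<open>\<delta>\<close> infinite cardinals lie below \<open>\<kappa>\<close>. Since \<open>\<delta>\<close> is uncountable, the set
  of all initial ordinals below \<open>\<kappa>\<close>, finite ones included, has size less than \<open>\<delta>\<close>
  (\<open>card_initials_less\<close>), so a disjunction of \<open>L\<^bsub>\<delta>,\<omega>\<^esub>\<close> can range over it. A disjunction of this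
  kind says that every element of \<open>\<kappa>\<close> has fewer than \<open>\<kappa>\<close> predecessors, by naming their number.

  In detail, consider \<open>\<kappa>\<close> as a structure with its order, with a constant for every element, and with
  a relation \<open>E\<close> that, for every \<open>x\<close>, enumerates the predecessors of \<open>x\<close> along the initial ordinal
  \<open>b\<close> of the same cardinality. In any model of its theory call the values of the constants standard.
  By induction on the initial ordinal \<open>a\<close>, all elements below \<open>a\<close> are standard. Indeed, let
  \<open>x < a\<close>. Then for some initial \<open>b < a\<close> the predecessors of \<open>x\<close> are enumerated along the elements
  below \<open>b\<close>, which are standard, so \<open>x\<close> has at most \<open>|b|\<close> predecessors. If \<open>x\<close> were not standard, it
  would lie above every standard \<open>\<alpha> < a\<close>: an element below \<open>\<alpha>\<close> is reached by enumerating along an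
  initial ordinal less than \<open>a\<close>, whose elements are standard, and a standard index has a standard
  value. Then \<open>x\<close> would have at least \<open>|a| > |b|\<close> predecessors. The same count, with \<open>\<kappa>\<close> for \<open>a\<close>,
  shows that the whole model is standard (\<open>no_new_elements\<close>, \<open>model_is_standard\<close>).

  Compactness contradicts this: the theory together with an element different from all \<open>\<kappa>\<close> many
  constants is satisfiable in every part of size less than \<open>\<kappa>\<close>, by \<open>\<kappa>\<close> itself
  (\<open>compact_new_element\<close>). So at least \<open>\<delta>\<close> infinite cardinals lie below \<open>\<kappa>\<close>, and \<open>\<kappa>\<close> or one of
  its initial segments is \<open>\<aleph>\<^bsub>\<delta>\<^esub>\<close> (\<open>aleph_exists\<close>).
\<close>

section \<open>Initial ordinals\<close>

definition init_rep :: "'k rel \<Rightarrow> 'k \<Rightarrow> 'k" where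
  "init_rep \<kappa> x = wo_rel.minim \<kappa> {y \<in> Field \<kappa>. |underS \<kappa> y| =o |underS \<kappa> x|}"

definition initials :: "'k rel \<Rightarrow> 'k set" where
  "initials \<kappa> = init_rep \<kappa> ` Field \<kappa>"

lemma underS_subset_Field: "underS r a \<subseteq> Field r"
  by (auto simp: underS_def Field_def)

lemma init_rep:
  assumes wo: "Well_order \<kappa>" and x: "x \<in> Field \<kappa>"
  shows "init_rep \<kappa> x \<in> Field \<kappa>"
    and "|underS \<kappa> (init_rep \<kappa> x)| =o |underS \<kappa> x|"
    and "(init_rep \<kappa> x, x) \<in> \<kappa>"
    and "\<And>y. y \<in> Field \<kappa> \<Longrightarrow> |underS \<kappa> y| =o |underS \<kappa> x| \<Longrightarrow> (init_rep \<kappa> x, y) \<in> \<kappa>"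
proof -
  let ?B = "{y \<in> Field \<kappa>. |underS \<kappa> y| =o |underS \<kappa> x|}"
  have w: "wo_rel \<kappa>" using wo by (simp add: wo_rel_def)
  have B: "?B \<subseteq> Field \<kappa>" "x \<in> ?B" "?B \<noteq> {}" using x card_of_refl by auto
  have "init_rep \<kappa> x \<in> ?B"
    unfolding init_rep_def by (rule wo_rel.minim_in[OF w B(1,3)])
  then show "init_rep \<kappa> x \<in> Field \<kappa>" "|underS \<kappa> (init_rep \<kappa> x)| =o |underS \<kappa> x|" by auto
  show "(init_rep \<kappa> x, x) \<in> \<kappa>"
    unfolding init_rep_def by (rule wo_rel.minim_least[OF w B(1,2)])
  show "(init_rep \<kappa> x, y) \<in> \<kappa>" if "y \<in> Field \<kappa>" "|underS \<kappa> y| =o |underS \<kappa> x|" for y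
    unfolding init_rep_def by (rule wo_rel.minim_least[OF w B(1)]) (use that in auto)
qed

lemma underS_mono:
  assumes wo: "Well_order \<kappa>" and "(y, x) \<in> \<kappa>"
  shows "underS \<kappa> y \<subseteq> underS \<kappa> x"
  using assms by (auto simp: underS_def order_on_defs dest: transD antisymD)

text \<open>
  This is what makes the elements of \<^const>\<open>initials\<close> initial ordinals; it holds because
  \<^const>\<open>init_rep\<close> picks the least ordinal of its cardinality.
\<close>

lemma underS_initial_less:
  assumes wo: "Well_order \<kappa>" and a: "a \<in> initials \<kappa>" and y: "y \<in> underS \<kappa> a"
  shows "|underS \<kappa> y| <o |underS \<kappa> a|"
proof -
  obtain x where x: "x \<in> Field \<kappa>" "a = init_rep \<kappa> x" using a by (auto simp: initials_def)
  have ya: "(y, a) \<in> \<kappa>" "y \<noteq> a" "y \<in> Field \<kappa>" using y by (auto simp: underS_def Field_def)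
  have "\<not> |underS \<kappa> y| =o |underS \<kappa> a|"
  proof
    assume "|underS \<kappa> y| =o |underS \<kappa> a|"
    then have "|underS \<kappa> y| =o |underS \<kappa> x|"
      using init_rep(2)[OF wo x(1)] x(2) ordIso_transitive by blast
    then have "(a, y) \<in> \<kappa>" using init_rep(4)[OF wo x(1) ya(3)] x(2) by simp
    then show False using ya wo by (auto simp: order_on_defs dest: antisymD)
  qed
  moreover have "|underS \<kappa> y| \<le>o |underS \<kappa> a|"
    using underS_mono[OF wo ya(1)] by (rule card_of_mono1)
  ultimately show ?thesis using ordLeq_iff_ordLess_or_ordIso by blast
qed

lemma initials_subset: "Well_order \<kappa> \<Longrightarrow> initials \<kappa> \<subseteq> Field \<kappa>"
  by (auto simp: initials_def init_rep(1))

lemma well_order_on_Restr: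
  assumes "Well_order r" "A \<subseteq> Field r" shows "well_order_on A (Restr r A)"
  using Well_order_Restr[OF assms(1), of A]
    Refl_Field_Restr2[of r A] assms by (simp add: order_on_defs)

lemma Restr_underS_less:
  assumes "Well_order r" "x \<in> Field r" shows "Restr r (underS r x) <o r"
  using underS_Restr_ordLess[OF assms(1)] assms(2) by blast

text \<open>
  Were \<open>a\<close> longer than the cardinal of its set of predecessors, that cardinal would be isomorphic to
  a proper initial segment of \<open>a\<close>, contrary to \<open>underS_initial_less\<close>.
\<close>

lemma infinite_initial_is_card:
  assumes wo: "Well_order \<kappa>" and a: "a \<in> initials \<kappa>" and inf: "infinite (underS \<kappa> a)"
  shows "a \<in> infinite_cards_below \<kappa>"
proof -
  let ?U = "underS \<kappa> a" let ?r = "Restr \<kappa> ?U"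
  have aF: "a \<in> Field \<kappa>" using a initials_subset[OF wo] by blast
  have UF: "?U \<subseteq> Field \<kappa>" by (rule underS_subset_Field)
  have wr: "well_order_on ?U ?r" using well_order_on_Restr[OF wo UF] .
  have Fr: "Field ?r = ?U" using wr well_order_on_Field by blast
  then have Wr: "Well_order ?r" using wr by simp
  have "?r \<le>o |?U|"
  proof (rule ccontr)
    assume "\<not> ?r \<le>o |?U|"
    then have "|?U| <o ?r" using Wr card_of_Well_order not_ordLeq_iff_ordLess by blast
    then obtain y where y: "y \<in> Field ?r" "|?U| =o Restr ?r (underS ?r y)"
      using ordLess_iff_ordIso_Restr[OF Wr card_of_Well_order] by blast
    have yU: "y \<in> ?U" using y Fr by simp
    have "|?U| =o |Field (Restr ?r (underS ?r y))|"
      using card_of_cong[OF y(2)] by (simp add: Field_card_of)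
    moreover have "Field (Restr ?r (underS ?r y)) \<subseteq> underS \<kappa> y"
      by (auto simp: Field_def underS_def)
    ultimately have "|?U| \<le>o |underS \<kappa> y|"
      using card_of_mono1 ordIso_ordLeq_trans by blast
    then show False using underS_initial_less[OF wo a yU] not_ordLess_ordLeq by blast
  qed
  then have "card_order_on ?U ?r"
    using wr card_of_least ordLeq_transitive unfolding card_order_on_def by blast
  then show ?thesis using aF inf by (simp add: infinite_cards_below_def)
qed

text \<open>An element with finitely many predecessors is determined by their number.\<close>

lemma finite_elements_countable:
  assumes wo: "Well_order \<kappa>"
  shows "|{a \<in> Field \<kappa>. finite (underS \<kappa> a)}| \<le>o natLeq"
proof -
  let ?A = "{a \<in> Field \<kappa>. finite (underS \<kappa> a)}"
  have less: "card (underS \<kappa> x) < card (underS \<kappa> y)"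
    if "finite (underS \<kappa> y)" "(x, y) \<in> \<kappa>" "x \<noteq> y" for x y
  proof (rule psubset_card_mono[OF that(1)])
    have "x \<in> underS \<kappa> y" "x \<notin> underS \<kappa> x" using that by (auto simp: underS_def)
    then show "underS \<kappa> x \<subset> underS \<kappa> y" using underS_mono[OF wo that(2)] by blast
  qed
  have "inj_on (\<lambda>a. card (underS \<kappa> a)) ?A"
  proof (rule inj_onI, rule ccontr)
    fix x y assume xy: "x \<in> ?A" "y \<in> ?A" "card (underS \<kappa> x) = card (underS \<kappa> y)" "x \<noteq> y"
    then have "(x, y) \<in> \<kappa> \<or> (y, x) \<in> \<kappa>"
      using wo by (auto simp: order_on_defs total_on_def)
    then show False using less[of x y] less[of y x] xy by auto
  qed
  then have "|?A| \<le>o |UNIV :: nat set|" using card_of_ordLeq by blast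
  then show ?thesis using card_of_nat ordLeq_ordIso_trans by blast
qed

lemma card_initials_less:
  assumes "Well_order \<kappa>" "Card_order \<delta>" "natLeq <o \<delta>"
    and few: "Restr \<kappa> (infinite_cards_below \<kappa>) <o \<delta>"
  shows "|initials \<kappa>| <o \<delta>"
proof -
  let ?K = "infinite_cards_below \<kappa>" and ?A = "{a \<in> Field \<kappa>. finite (underS \<kappa> a)}"
  have "?K \<subseteq> Field \<kappa>" by (auto simp: infinite_cards_below_def)
  then have "|?K| \<le>o Restr \<kappa> ?K" using well_order_on_Restr[OF assms(1)] card_of_least by blast
  then have K: "|?K| <o \<delta>" using few ordLeq_ordLess_trans by blast
  have A: "|?A| <o \<delta>"
    using finite_elements_countable[OF assms(1)] assms(3) ordLeq_ordLess_trans by blast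
  have "infinite (Field \<delta>)"
    using assms(2,3) natLeq_Well_order ordLess_imp_ordLeq
    by (metis Field_natLeq Card_order_iff_ordLeq_card_of card_of_ordLeq_infinite card_of_mono2
        infinite_UNIV_nat)
  then have "|?K \<union> ?A| <o \<delta>" using card_of_Un_ordLess_infinite_Field[OF _ assms(2) K A] by blast
  moreover have "initials \<kappa> \<subseteq> ?K \<union> ?A"
    using infinite_initial_is_card[OF assms(1)] initials_subset[OF assms(1)] by blast
  ultimately show ?thesis using card_of_mono1 ordLeq_ordLess_trans by blast
qed

text \<open>
  Either \<open>\<kappa>\<close> is \<open>\<aleph>\<^bsub>\<delta>\<^esub>\<close>, or the \<open>\<delta>\<close>-th infinite cardinal is an element \<open>x\<close> of \<open>\<kappa>\<close>. In the second case
  the segment below \<open>x\<close> has the same infinite cardinals as \<open>\<kappa>\<close> has below \<open>x\<close>, because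
  \<^const>\<open>infinite_cards_below\<close> refers only to initial segments.
\<close>

lemma aleph_exists:
  fixes \<delta> :: "'d rel" and \<kappa> :: "'k rel"
  assumes card: "Card_order \<kappa>" and inf: "infinite (Field \<kappa>)"
    and le: "\<delta> \<le>o Restr \<kappa> (infinite_cards_below \<kappa>)"
  shows "\<exists>c :: 'k rel. is_aleph \<delta> c \<and> c \<le>o \<kappa>"
proof (cases "\<delta> =o Restr \<kappa> (infinite_cards_below \<kappa>)")
  case True
  then have "is_aleph \<delta> \<kappa>" using card inf ordIso_symmetric by (auto simp: is_aleph_def)
  then show ?thesis using card ordLeq_reflexive unfolding card_order_on_def by blast
next
  case False
  let ?K = "infinite_cards_below \<kappa>"
  let ?R = "Restr \<kappa> ?K"
  have wo: "Well_order \<kappa>" using card by (rule card_order_on_well_order_on)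
  have KF: "?K \<subseteq> Field \<kappa>" by (auto simp: infinite_cards_below_def)
  have FR: "Field ?R = ?K" using well_order_on_Restr[OF wo KF] well_order_on_Field by blast
  have "\<delta> <o ?R" using False le ordLeq_iff_ordLess_or_ordIso by blast
  moreover have "Well_order ?R" "Well_order \<delta>"
    using le by (simp_all add: ordLeq_def)
  ultimately obtain x where x: "x \<in> Field ?R" and iso: "\<delta> =o Restr ?R (underS ?R x)"
    using ordLess_iff_ordIso_Restr by blast
  have xK: "x \<in> ?K" using x FR by simp
  then have xF: "x \<in> Field \<kappa>" using KF by blast
  define c where "c = Restr \<kappa> (underS \<kappa> x)"
  have co: "card_order_on (underS \<kappa> x) c" "infinite (underS \<kappa> x)"
    using xK by (simp_all add: infinite_cards_below_def c_def)
  have Fc: "Field c = underS \<kappa> x" using co(1) card_order_on_Card_order by blast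
  have sub: "underS \<kappa> y \<subseteq> underS \<kappa> x" if "y \<in> underS \<kappa> x" for y
    using underS_mono[OF wo, of y x] that by (auto simp: underS_def)
  have us: "underS c y = underS \<kappa> y" if "y \<in> underS \<kappa> x" for y
    using sub[OF that] that by (auto simp: c_def underS_def)
  have re: "Restr c (underS \<kappa> y) = Restr \<kappa> (underS \<kappa> y)" if "y \<in> underS \<kappa> x" for y
    using sub[OF that] by (auto simp: c_def)
  have "infinite_cards_below c = ?K \<inter> underS \<kappa> x"
    using underS_subset_Field[of \<kappa> x] us re by (auto simp: infinite_cards_below_def Fc)
  then have "Restr c (infinite_cards_below c) = Restr ?R (underS ?R x)"
    using xK by (auto simp: c_def underS_def)
  then have "is_aleph \<delta> c"
    using iso co Fc ordIso_symmetric by (auto simp: is_aleph_def)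
  moreover have "c \<le>o \<kappa>"
    unfolding c_def using Restr_underS_less[OF wo xF] by (rule ordLess_imp_ordLeq)
  ultimately show ?thesis by blast
qed

section \<open>The combinatorial core\<close>

text \<open>
  The counting argument, free of logic. Here \<open>c\<close> gives the values of the constants in the structure
  \<open>M\<close>, and \<open>E x z y\<close> says that \<open>y\<close> is the predecessor of \<open>x\<close> with index \<open>z\<close>. The relation
  \<open>lt\<close> may be ill-founded on \<open>M\<close>, so the induction runs over \<open>\<kappa>\<close>. The hypothesis \<open>strata\<close> is the only one
  that takes an infinite disjunction to express. Its bound \<open>lt (c b) (c \<alpha>)\<close> makes the induction
  descend, and for \<open>x\<close> above all \<open>c \<alpha>\<close> it is void.
\<close>

lemma no_new_elements:
  fixes \<kappa> :: "'k rel" and M :: "'m set" and c :: "'k \<Rightarrow> 'm"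
    and lt :: "'m \<Rightarrow> 'm \<Rightarrow> bool" and E :: "'m \<Rightarrow> 'm \<Rightarrow> 'm \<Rightarrow> bool"
  assumes card: "Card_order \<kappa>" and ne: "Field \<kappa> \<noteq> {}"
    and c_in: "\<And>\<alpha>. \<alpha> \<in> Field \<kappa> \<Longrightarrow> c \<alpha> \<in> M"
    and c_inj: "inj_on c (Field \<kappa>)"
    and linear: "\<And>x \<alpha>. x \<in> M \<Longrightarrow> \<alpha> \<in> Field \<kappa> \<Longrightarrow> lt x (c \<alpha>) \<or> x = c \<alpha> \<or> lt (c \<alpha>) x"
    and reflect: "\<And>\<xi> \<alpha>. \<xi> \<in> Field \<kappa> \<Longrightarrow> \<alpha> \<in> Field \<kappa> \<Longrightarrow> lt (c \<xi>) (c \<alpha>) \<Longrightarrow> \<xi> \<in> underS \<kappa> \<alpha>"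
    and functional: "\<And>x z y y'. x \<in> M \<Longrightarrow> z \<in> M \<Longrightarrow> y \<in> M \<Longrightarrow> y' \<in> M \<Longrightarrow>
      E x z y \<Longrightarrow> E x z y' \<Longrightarrow> y = y'"
    and onto: "\<And>x \<alpha>. x \<in> M \<Longrightarrow> \<alpha> \<in> Field \<kappa> \<Longrightarrow> lt x (c \<alpha>) \<Longrightarrow>
      \<exists>z\<in>M. lt z (c (init_rep \<kappa> \<alpha>)) \<and> E (c \<alpha>) z x"
    and standard: "\<And>\<alpha> \<xi>. \<alpha> \<in> Field \<kappa> \<Longrightarrow> \<xi> \<in> underS \<kappa> (init_rep \<kappa> \<alpha>) \<Longrightarrow>
      \<exists>\<eta>\<in>Field \<kappa>. E (c \<alpha>) (c \<xi>) (c \<eta>)"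
    and strata: "\<And>x \<alpha>. x \<in> M \<Longrightarrow> \<alpha> \<in> Field \<kappa> \<Longrightarrow> \<exists>b\<in>initials \<kappa>.
      (lt x (c \<alpha>) \<longrightarrow> lt (c b) (c \<alpha>)) \<and> (\<forall>y\<in>M. lt y x \<longrightarrow> (\<exists>z\<in>M. lt z (c b) \<and> E x z y))"
  shows "M \<subseteq> c ` Field \<kappa>"
proof -
  have wo: "Well_order \<kappa>" using card by (rule card_order_on_well_order_on)
  define std where "std b \<longleftrightarrow> (\<forall>z\<in>M. lt z (c b) \<longrightarrow> z \<in> c ` underS \<kappa> b)" for b
  \<comment> \<open>An element \<open>x\<close> below \<open>c \<alpha>\<close> has an index below \<open>init_rep \<kappa> \<alpha>\<close>; if that index is standard, so is \<open>x\<close>.\<close>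
  have below: "x \<in> c ` Field \<kappa>"
    if x: "x \<in> M" "\<alpha> \<in> Field \<kappa>" "lt x (c \<alpha>)" "std (init_rep \<kappa> \<alpha>)" for x \<alpha>
  proof -
    obtain z where z: "z \<in> M" "lt z (c (init_rep \<kappa> \<alpha>))" "E (c \<alpha>) z x"
      using onto[OF x(1-3)] by blast
    then obtain \<xi> where \<xi>: "\<xi> \<in> underS \<kappa> (init_rep \<kappa> \<alpha>)" "z = c \<xi>"
      using x(4) unfolding std_def by blast
    then obtain \<eta> where \<eta>: "\<eta> \<in> Field \<kappa>" "E (c \<alpha>) z (c \<eta>)" using standard[OF x(2)] by blast
    have "x = c \<eta>" using functional[OF c_in[OF x(2)] z(1) x(1) c_in[OF \<eta>(1)] z(3) \<eta>(2)] .
    then show ?thesis using \<eta>(1) by blast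
  qed
  \<comment> \<open>A nonstandard \<open>x\<close> lies above all of \<open>A\<close>, and its predecessors are listed along \<open>b\<close>.\<close>
  have small: "|A| \<le>o |underS \<kappa> b|"
    if x: "x \<in> M" "x \<notin> c ` Field \<kappa>" and A: "A \<subseteq> Field \<kappa>"
      and stdA: "\<And>\<alpha>. \<alpha> \<in> A \<Longrightarrow> std (init_rep \<kappa> \<alpha>)" and b: "std b"
      and cov: "\<forall>y\<in>M. lt y x \<longrightarrow> (\<exists>z\<in>M. lt z (c b) \<and> E x z y)" for x A b
  proof -
    have "\<exists>\<xi>. \<xi> \<in> underS \<kappa> b \<and> E x (c \<xi>) (c \<alpha>)" if \<alpha>: "\<alpha> \<in> A" for \<alpha>
    proof -
      have \<alpha>F: "\<alpha> \<in> Field \<kappa>" using A \<alpha> by blast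
      have "\<not> lt x (c \<alpha>)" using below[OF x(1) \<alpha>F _ stdA[OF \<alpha>]] x(2) by blast
      then have "lt (c \<alpha>) x" using linear[OF x(1) \<alpha>F] x(2) \<alpha>F by blast
      then obtain z where "z \<in> M" "lt z (c b)" "E x z (c \<alpha>)" using cov c_in[OF \<alpha>F] by blast
      then show ?thesis using b unfolding std_def by blast
    qed
    then obtain h where h: "\<And>\<alpha>. \<alpha> \<in> A \<Longrightarrow> h \<alpha> \<in> underS \<kappa> b \<and> E x (c (h \<alpha>)) (c \<alpha>)" by metis
    have "inj_on h A"
    proof (rule inj_onI)
      fix \<alpha> \<beta> assume ab: "\<alpha> \<in> A" "\<beta> \<in> A" "h \<alpha> = h \<beta>"
      have "h \<alpha> \<in> Field \<kappa>" using h[OF ab(1)] underS_subset_Field[of \<kappa> b] by blast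
      then have "c \<alpha> = c \<beta>"
        using functional[OF x(1), of "c (h \<alpha>)" "c \<alpha>" "c \<beta>"] h[OF ab(1)] h[OF ab(2)] ab A c_in
        by auto
      then show "\<alpha> = \<beta>" using c_inj ab A by (auto dest: inj_onD)
    qed
    then show ?thesis using h card_of_ordLeq[of A "underS \<kappa> b"] by blast
  qed
  have std: "b \<in> initials \<kappa> \<longrightarrow> std b" for b
  proof (rule wf_induct_rule[of "\<kappa> - Id"])
    show "wf (\<kappa> - Id)" using wo by (simp add: well_order_on_def)
    fix b assume IH: "\<And>a. (a, b) \<in> \<kappa> - Id \<Longrightarrow> a \<in> initials \<kappa> \<longrightarrow> std a"
    show "b \<in> initials \<kappa> \<longrightarrow> std b"
    proof
      assume b: "b \<in> initials \<kappa>"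
      then have bF: "b \<in> Field \<kappa>" using initials_subset[OF wo] by blast
      have stdU: "std (init_rep \<kappa> \<alpha>)" if \<alpha>: "\<alpha> \<in> underS \<kappa> b" for \<alpha>
      proof -
        have \<alpha>F: "\<alpha> \<in> Field \<kappa>" using \<alpha> underS_subset_Field[of \<kappa> b] by blast
        have "(init_rep \<kappa> \<alpha>, b) \<in> \<kappa> - Id"
          using init_rep(3)[OF wo \<alpha>F] \<alpha> wo
          by (auto simp: underS_def order_on_defs dest: transD antisymD)
        then show ?thesis using IH \<alpha>F by (auto simp: initials_def)
      qed
      show "std b"
        unfolding std_def
      proof (intro ballI impI)
        fix x assume x: "x \<in> M" "lt x (c b)"
        obtain a where a: "a \<in> initials \<kappa>" "lt (c a) (c b)"
          and cov: "\<forall>y\<in>M. lt y x \<longrightarrow> (\<exists>z\<in>M. lt z (c a) \<and> E x z y)"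
          using strata[OF x(1) bF] x(2) by blast
        have aF: "a \<in> Field \<kappa>" using a initials_subset[OF wo] by blast
        have ab: "a \<in> underS \<kappa> b" using reflect[OF aF bF a(2)] .
        then have "std a" using IH a(1) by (auto simp: underS_def)
        then have "|underS \<kappa> b| \<le>o |underS \<kappa> a|" if "x \<notin> c ` Field \<kappa>"
          using small[OF x(1) that underS_subset_Field stdU] cov by blast
        then have "x \<in> c ` Field \<kappa>"
          using underS_initial_less[OF wo b ab] not_ordLess_ordLeq by blast
        then show "x \<in> c ` underS \<kappa> b" using reflect[OF _ bF] x(2) by blast
      qed
    qed
  qed
  have all: "std (init_rep \<kappa> \<alpha>)" if "\<alpha> \<in> Field \<kappa>" for \<alpha>
    using std that by (simp add: initials_def)
  show ?thesis
  proof (rule subsetI, rule ccontr)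
    fix x assume x: "x \<in> M" "x \<notin> c ` Field \<kappa>"
    obtain \<alpha> where "\<alpha> \<in> Field \<kappa>" using ne by blast
    then obtain b where b: "b \<in> initials \<kappa>"
      and cov: "\<forall>y\<in>M. lt y x \<longrightarrow> (\<exists>z\<in>M. lt z (c b) \<and> E x z y)"
      using strata[OF x(1)] by blast
    have "|Field \<kappa>| \<le>o |underS \<kappa> b|"
      using small[OF x subset_refl all] b std cov by blast
    moreover have "|underS \<kappa> b| <o \<kappa>"
      using card_of_underS[OF card] b initials_subset[OF wo] by blast
    ultimately have "|Field \<kappa>| <o \<kappa>" using ordLeq_ordLess_trans by blast
    then show False using card_of_Field_ordIso[OF card] not_ordLess_ordIso by blast
  qed
qed

section \<open>Disjunctions over arbitrary small sets\<close>

text \<open>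
  The index sets of \<^const>\<open>Disj\<close> live in the type that carries \<open>\<delta>\<close>; any other index set of size
  less than \<open>\<delta>\<close> is first transported there by an injection.
\<close>

definition big_disj :: "'a set \<Rightarrow> ('a \<Rightarrow> ('d, 's) fm) \<Rightarrow> ('d, 's) fm" where
  "big_disj A F = (let g = (SOME g. inj_on g A) in Disj (g ` A) (\<lambda>i. F (inv_into A g i)))"

lemma big_disj:
  fixes \<delta> :: "'d rel" and F :: "'a \<Rightarrow> ('d, 's) fm"
  assumes "|A| <o \<delta>"
  shows "sat M (big_disj A F) e \<longleftrightarrow> (\<exists>a\<in>A. sat M (F a) e)"
    and "free_vars (big_disj A F) = (\<Union>a\<in>A. free_vars (F a))"
    and "is_formula \<delta> L (big_disj A F) \<longleftrightarrow>
      (\<forall>a\<in>A. is_formula \<delta> L (F a)) \<and> finite (\<Union>a\<in>A. free_vars (F a))"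
proof -
  define g :: "'a \<Rightarrow> 'd" where "g = (SOME g. inj_on g A)"
  have "|A| \<le>o |Field \<delta>|"
    using card_of_mono2[OF ordLess_imp_ordLeq[OF assms]] by (simp add: Field_card_of)
  then have "\<exists>g :: 'a \<Rightarrow> 'd. inj_on g A" using card_of_ordLeq[of A "Field \<delta>"] by blast
  then have g: "inj_on g A" unfolding g_def by (rule someI_ex)
  have eq: "big_disj A F = Disj (g ` A) (\<lambda>i. F (inv_into A g i))"
    unfolding big_disj_def g_def Let_def ..
  have "|g ` A| <o \<delta>" using card_of_image assms ordLeq_ordLess_trans by blast
  then show "sat M (big_disj A F) e \<longleftrightarrow> (\<exists>a\<in>A. sat M (F a) e)"
    and "free_vars (big_disj A F) = (\<Union>a\<in>A. free_vars (F a))"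
    and "is_formula \<delta> L (big_disj A F) \<longleftrightarrow>
      (\<forall>a\<in>A. is_formula \<delta> L (F a)) \<and> finite (\<Union>a\<in>A. free_vars (F a))"
    using g by (simp_all add: eq)
qed

definition disj2 :: "('d, 's) fm \<Rightarrow> ('d, 's) fm \<Rightarrow> ('d, 's) fm" where
  "disj2 \<phi> \<psi> = big_disj UNIV (\<lambda>b. if b then \<phi> else \<psi>)"

definition conj2 :: "('d, 's) fm \<Rightarrow> ('d, 's) fm \<Rightarrow> ('d, 's) fm" where
  "conj2 \<phi> \<psi> = Neg (disj2 (Neg \<phi>) (Neg \<psi>))"

definition imp :: "('d, 's) fm \<Rightarrow> ('d, 's) fm \<Rightarrow> ('d, 's) fm" where
  "imp \<phi> \<psi> = disj2 (Neg \<phi>) \<psi>"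

lemma connectives:
  fixes \<delta> :: "'d rel" and \<phi> \<psi> :: "('d, 's) fm"
  assumes "natLeq <o \<delta>"
  shows "sat M (disj2 \<phi> \<psi>) e \<longleftrightarrow> sat M \<phi> e \<or> sat M \<psi> e"
    and "sat M (conj2 \<phi> \<psi>) e \<longleftrightarrow> sat M \<phi> e \<and> sat M \<psi> e"
    and "sat M (imp \<phi> \<psi>) e \<longleftrightarrow> (sat M \<phi> e \<longrightarrow> sat M \<psi> e)"
    and "free_vars (disj2 \<phi> \<psi>) = free_vars \<phi> \<union> free_vars \<psi>"
    and "free_vars (conj2 \<phi> \<psi>) = free_vars \<phi> \<union> free_vars \<psi>"
    and "free_vars (imp \<phi> \<psi>) = free_vars \<phi> \<union> free_vars \<psi>"
    and "is_formula \<delta> L (disj2 \<phi> \<psi>) \<longleftrightarrow> is_formula \<delta> L \<phi> \<and> is_formula \<delta> L \<psi>"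
    and "is_formula \<delta> L (conj2 \<phi> \<psi>) \<longleftrightarrow> is_formula \<delta> L \<phi> \<and> is_formula \<delta> L \<psi>"
    and "is_formula \<delta> L (imp \<phi> \<psi>) \<longleftrightarrow> is_formula \<delta> L \<phi> \<and> is_formula \<delta> L \<psi>"
proof -
  have "|UNIV :: bool set| <o natLeq" using finite_iff_ordLess_natLeq[of "UNIV :: bool set"] by simp
  then have small: "|UNIV :: bool set| <o \<delta>" using assms by (rule ordLess_transitive)
  note d = big_disj[OF small]
  show "sat M (disj2 \<phi> \<psi>) e \<longleftrightarrow> sat M \<phi> e \<or> sat M \<psi> e"
    and "sat M (conj2 \<phi> \<psi>) e \<longleftrightarrow> sat M \<phi> e \<and> sat M \<psi> e"
    and "sat M (imp \<phi> \<psi>) e \<longleftrightarrow> (sat M \<phi> e \<longrightarrow> sat M \<psi> e)"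
    and "free_vars (disj2 \<phi> \<psi>) = free_vars \<phi> \<union> free_vars \<psi>"
    and "free_vars (conj2 \<phi> \<psi>) = free_vars \<phi> \<union> free_vars \<psi>"
    and "free_vars (imp \<phi> \<psi>) = free_vars \<phi> \<union> free_vars \<psi>"
    unfolding imp_def conj2_def disj2_def by (auto simp: d ex_bool_eq split: if_splits)
  show "is_formula \<delta> L (disj2 \<phi> \<psi>) \<longleftrightarrow> is_formula \<delta> L \<phi> \<and> is_formula \<delta> L \<psi>"
    and "is_formula \<delta> L (conj2 \<phi> \<psi>) \<longleftrightarrow> is_formula \<delta> L \<phi> \<and> is_formula \<delta> L \<psi>"
    and "is_formula \<delta> L (imp \<phi> \<psi>) \<longleftrightarrow> is_formula \<delta> L \<phi> \<and> is_formula \<delta> L \<psi>"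
    unfolding imp_def conj2_def disj2_def
    by (auto simp: d all_bool_eq dest: finite_free_vars)
qed

section \<open>A new element by compactness\<close>

definition with_pred :: "'s \<Rightarrow> 'm set \<Rightarrow> ('s, 'm) struct \<Rightarrow> ('s, 'm) struct" where
  "with_pred d D N = N\<lparr>rint := (rint N)(d := \<lambda>as. hd as \<in> D)\<rparr>"

lemma with_pred_simps [simp]:
  "univ (with_pred d D N) = univ N" "fint (with_pred d D N) = fint N"
  "rint (with_pred d D N) r = (if r = d then (\<lambda>as. hd as \<in> D) else rint N r)"
  by (simp_all add: with_pred_def)

text \<open>
  The sentences that hold whatever set \<open>d\<close> stands for. They include the theory of the reduct without
  \<open>d\<close>, and hold in \<open>N\<close> together with any further requirement on \<open>d\<close> that some set meets.
\<close>

definition robust_theory ::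
  "'d rel \<Rightarrow> ('s, 'z) language_scheme \<Rightarrow> 's \<Rightarrow> ('s, 'm) struct \<Rightarrow> ('d, 's) fm set" where
  "robust_theory \<delta> L d N =
     {\<phi> \<in> sentences \<delta> L. \<forall>D e. range e \<subseteq> univ N \<longrightarrow> sat (with_pred d D N) \<phi> e}"

text \<open>
  The predicate \<open>d\<close> plays the part of a new constant: it is asked to hold somewhere, and to fail at
  every constant in \<open>A\<close>. Fewer than \<open>\<kappa>\<close> of these requirements leave out a constant \<open>p\<close>, and they
  hold in \<open>N\<close> when \<open>d\<close> is true at \<open>p\<close> only.
\<close>

lemma compact_new_element:
  fixes \<delta> :: "'d rel" and \<kappa> :: "'k rel" and L :: "'k language" and N :: "('k, 'm) struct"
  assumes compact: "compact_card \<delta> \<kappa> \<kappa>" and L: "|symbols L| \<le>o \<kappa>"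
    and inf: "infinite (UNIV :: 'k set)" and le: "\<delta> \<le>o |UNIV :: 'k set|"
    and N: "is_structure L N" and d: "d \<in> rels L" "rarity L d = 1"
    and A: "A \<subseteq> funs L" "\<And>a. a \<in> A \<Longrightarrow> farity L a = 0" "inj_on (\<lambda>a. fint N a []) A" "\<kappa> \<le>o |A|"
  obtains M :: "('k, 'k set) struct" and x where
    "is_model L (robust_theory \<delta> L d N) M" "x \<in> univ M" "\<And>a. a \<in> A \<Longrightarrow> x \<noteq> fint M a []"
proof -
  let ?dx = "Rel d [Var 0] :: ('d, 'k) fm"
  define neg :: "'k \<Rightarrow> ('d, 'k) fm" where "neg a = Neg (Rel d [Fn a []])" for a
  define T where "T = robust_theory \<delta> L d N \<union> ({Ex 0 ?dx} \<union> neg ` A)"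
  have T: "T \<subseteq> sentences \<delta> L"
    using A d by (auto simp: T_def robust_theory_def sentences_def neg_def)
  have constN: "fint N a [] \<in> univ N" if "a \<in> A" for a
    using N A(1,2) that unfolding is_structure_def by (auto dest!: bspec[where x = "[]"])
  have "satisfiable L S" if S: "S \<subseteq> T" "|S| <o \<kappa>" for S
  proof -
    let ?B = "{a \<in> A. neg a \<in> S}"
    have "inj_on neg ?B" by (auto simp: neg_def inj_on_def)
    then have "|?B| \<le>o |S|" using card_of_ordLeq[of ?B S] by blast
    then have "|?B| <o |A|"
      using S(2) A(4) ordLeq_ordLess_trans ordLess_ordLeq_trans by blast
    then have "\<not> A \<subseteq> ?B" using card_of_mono1 not_ordLess_ordLeq by blast
    then obtain p where p: "p \<in> A" "neg p \<notin> S" by blast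
    let ?N = "with_pred d {fint N p []} N"
    have "sat ?N \<phi> e" if \<phi>: "\<phi> \<in> S" and e: "range e \<subseteq> univ N" for \<phi> e
    proof -
      consider "\<phi> \<in> robust_theory \<delta> L d N" | "\<phi> = Ex 0 ?dx" | a where "a \<in> A" "\<phi> = neg a"
        using \<phi> S(1) unfolding T_def by blast
      then show ?thesis
      proof cases
        case 1 then show ?thesis using e by (auto simp: robust_theory_def)
      next
        case 2 then show ?thesis using constN[OF p(1)] by simp
      next
        case 3
        then have "a \<noteq> p" using \<phi> p(2) by auto
        then show ?thesis using 3 p(1) A(3) by (auto simp: neg_def dest: inj_onD)
      qed
    qed
    moreover have "is_structure L ?N" using N by (simp add: is_structure_def)
    ultimately have "is_model L S ?N" by (simp add: is_model_def)
    then show ?thesis using satisfiable_if_model[OF inf le] S(1) T by blast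
  qed
  then have "lt_satisfiable \<kappa> L T" by (simp add: lt_satisfiable_def)
  then have "satisfiable L T"
    using compact[unfolded compact_card_def, rule_format, of L T] L T by simp
  then obtain M :: "('k, 'k set) struct" where M: "is_model L T M"
    unfolding satisfiable_def by blast
  then have st: "is_structure L M"
    and sat: "\<And>\<phi> e. \<phi> \<in> T \<Longrightarrow> range e \<subseteq> univ M \<Longrightarrow> sat M \<phi> e"
    by (auto simp: is_model_def)
  have model: "is_model L (robust_theory \<delta> L d N) M"
    using M unfolding is_model_def T_def by blast
  obtain u where u: "u \<in> univ M" using st by (auto simp: is_structure_def)
  have "sat M (Ex 0 ?dx) (\<lambda>_. u)" by (rule sat) (use u in \<open>auto simp: T_def\<close>)
  then obtain x where x: "x \<in> univ M" "rint M d [x]" by auto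
  have "x \<noteq> fint M a []" if "a \<in> A" for a
  proof -
    have "sat M (neg a) (\<lambda>_. u)" by (rule sat) (use u that in \<open>auto simp: T_def\<close>)
    then show ?thesis using x(2) by (auto simp: neg_def)
  qed
  with model x(1) show thesis by (rule that)
qed

section \<open>The structure on a cardinal\<close>

definition enum_below :: "'k rel \<Rightarrow> 'k \<Rightarrow> 'k \<Rightarrow> 'k" where
  "enum_below \<kappa> x = (SOME f. bij_betw f (underS \<kappa> (init_rep \<kappa> x)) (underS \<kappa> x))"

lemma enum_below:
  assumes "Well_order \<kappa>" "x \<in> Field \<kappa>"
  shows "bij_betw (enum_below \<kappa> x) (underS \<kappa> (init_rep \<kappa> x)) (underS \<kappa> x)"
proof -
  have "\<exists>f. bij_betw f (underS \<kappa> (init_rep \<kappa> x)) (underS \<kappa> x)"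
    using init_rep(2)[OF assms] card_of_ordIso by blast
  then show ?thesis unfolding enum_below_def by (rule someI_ex)
qed

text \<open>
  The function symbols are the elements of \<open>\<kappa>\<close>, as constants that name themselves. The symbol \<open>l\<close> is
  the order, \<open>e\<close> is the graph of \<^const>\<open>enum_below\<close> (element, index, value), and \<open>d\<close> is the unary
  predicate to which \<^const>\<open>robust_theory\<close> refers.
\<close>

definition card_lang :: "'k rel \<Rightarrow> 'k \<Rightarrow> 'k \<Rightarrow> 'k \<Rightarrow> 'k language" where
  "card_lang \<kappa> l e d = \<lparr>funs = Field \<kappa>, rels = {l, e, d}, farity = \<lambda>_. 0,
     rarity = (\<lambda>_. 1)(l := 2, e := 3)\<rparr>"

definition card_struct :: "'k rel \<Rightarrow> 'k \<Rightarrow> 'k \<Rightarrow> ('k, 'k) struct" where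
  "card_struct \<kappa> l e = \<lparr>univ = Field \<kappa>, fint = \<lambda>f as. f,
     rint = (\<lambda>_ _. False)
       (l := \<lambda>as. as ! 0 \<in> underS \<kappa> (as ! 1),
        e := \<lambda>as. as ! 1 \<in> underS \<kappa> (init_rep \<kappa> (as ! 0)) \<and> as ! 2 = enum_below \<kappa> (as ! 0) (as ! 1))\<rparr>"

text \<open>
  Every hypothesis of \<open>no_new_elements\<close> is written as a sentence that holds in \<^const>\<open>card_struct\<close>,
  and is read off in \<open>M\<close>. The one about strata is a disjunction over all initial ordinals below \<open>\<kappa>\<close>,
  hence a sentence of \<open>L\<^bsub>\<delta>,\<omega>\<^esub>\<close> because there are fewer than \<open>\<delta>\<close> of them.
\<close>

lemma model_is_standard:
  fixes \<delta> :: "'d rel" and \<kappa> :: "'k rel" and M :: "('k, 'm) struct"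
  assumes card: "Card_order \<kappa>" and inf: "infinite (Field \<kappa>)" and \<delta>: "natLeq <o \<delta>"
    and few: "|initials \<kappa>| <o \<delta>"
    and dist: "l \<noteq> e" "l \<noteq> d" "e \<noteq> d"
    and model: "is_model (card_lang \<kappa> l e d)
      (robust_theory \<delta> (card_lang \<kappa> l e d) d (card_struct \<kappa> l e)) M"
  shows "univ M \<subseteq> (\<lambda>\<alpha>. fint M \<alpha> []) ` Field \<kappa>"
proof -
  let ?L = "card_lang \<kappa> l e d"
  let ?N = "\<lambda>D. with_pred d D (card_struct \<kappa> l e)"
  define lt :: "'k tm \<Rightarrow> 'k tm \<Rightarrow> ('d, 'k) fm" where "lt s t = Rel l [s, t]" for s t
  define E :: "'k tm \<Rightarrow> 'k tm \<Rightarrow> 'k tm \<Rightarrow> ('d, 'k) fm" where "E s t u = Rel e [s, t, u]" for s t u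
  define c :: "'k \<Rightarrow> 'k tm" where "c \<alpha> = Fn \<alpha> []" for \<alpha>
  have wo: "Well_order \<kappa>" using card by (rule card_order_on_well_order_on)
  have iF: "initials \<kappa> \<subseteq> Field \<kappa>" by (rule initials_subset[OF wo])
  have rF: "\<alpha> \<in> Field \<kappa> \<Longrightarrow> init_rep \<kappa> \<alpha> \<in> Field \<kappa>" for \<alpha> by (rule init_rep(1)[OF wo])
  have uF: "\<xi> \<in> underS \<kappa> \<alpha> \<Longrightarrow> \<xi> \<in> Field \<kappa>" for \<xi> \<alpha> using underS_subset_Field[of \<kappa> \<alpha>] by blast
  have st: "is_structure ?L M" using model by (simp add: is_model_def)
  note well_formed = dist dist[symmetric] sentences_def lt_def E_def c_def card_lang_def
    connectives[OF \<delta>] big_disj[OF few]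
  note semantics = lt_def E_def c_def card_struct_def dist dist[symmetric] connectives[OF \<delta>]
    big_disj[OF few]
  obtain u where u: "u \<in> univ M" using st by (auto simp: is_structure_def)
  have transfer: "sat M \<phi> (\<lambda>_. u)"
    if "\<phi> \<in> sentences \<delta> ?L" "\<And>D v. sat (?N D) \<phi> v" for \<phi>
    using model that u by (auto simp: is_model_def robust_theory_def)
  show ?thesis
  proof (rule no_new_elements[OF card, where lt = "\<lambda>x y. rint M l [x, y]"
        and E = "\<lambda>x z y. rint M e [x, z, y]"])
    show "Field \<kappa> \<noteq> {}" using inf by auto
    show "fint M \<alpha> [] \<in> univ M" if "\<alpha> \<in> Field \<kappa>" for \<alpha>
      using st that unfolding is_structure_def card_lang_def by (auto dest!: bspec[where x = "[]"])
    show "inj_on (\<lambda>\<alpha>. fint M \<alpha> []) (Field \<kappa>)"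
    proof (rule inj_onI, rule ccontr)
      fix \<alpha> \<beta> assume a: "\<alpha> \<in> Field \<kappa>" "\<beta> \<in> Field \<kappa>" "fint M \<alpha> [] = fint M \<beta> []" "\<alpha> \<noteq> \<beta>"
      have "sat M (Neg (Eq (c \<alpha>) (c \<beta>)) :: ('d, 'k) fm) (\<lambda>_. u)"
        by (rule transfer) (use a in \<open>simp_all add: well_formed semantics\<close>)
      then show False using a(3) by (simp add: semantics)
    qed
    show "rint M l [x, fint M \<alpha> []] \<or> x = fint M \<alpha> [] \<or> rint M l [fint M \<alpha> [], x]"
      if "x \<in> univ M" "\<alpha> \<in> Field \<kappa>" for x \<alpha>
    proof -
      have "sat M (All 0 (disj2 (lt (Var 0) (c \<alpha>)) (disj2 (Eq (Var 0) (c \<alpha>)) (lt (c \<alpha>) (Var 0)))))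
        (\<lambda>_. u)"
      proof (rule transfer)
        have "y \<in> underS \<kappa> \<alpha> \<or> y = \<alpha> \<or> \<alpha> \<in> underS \<kappa> y" if "y \<in> Field \<kappa>" for y
          using wo that \<open>\<alpha> \<in> Field \<kappa>\<close> by (auto simp: underS_def order_on_defs total_on_def)
        then show "sat (?N D) (All 0 (disj2 (lt (Var 0) (c \<alpha>))
            (disj2 (Eq (Var 0) (c \<alpha>)) (lt (c \<alpha>) (Var 0))))) v" for D v
          by (simp add: semantics)
      qed (use that in \<open>simp add: well_formed\<close>)
      then show ?thesis using that by (simp add: semantics)
    qed
    show "\<xi> \<in> underS \<kappa> \<alpha>"
      if "\<xi> \<in> Field \<kappa>" "\<alpha> \<in> Field \<kappa>" "rint M l [fint M \<xi> [], fint M \<alpha> []]" for \<xi> \<alpha>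
    proof (rule ccontr)
      assume n: "\<xi> \<notin> underS \<kappa> \<alpha>"
      have "sat M (Neg (lt (c \<xi>) (c \<alpha>))) (\<lambda>_. u)"
        by (rule transfer) (use that n in \<open>simp_all add: well_formed semantics\<close>)
      then show False using that(3) by (simp add: semantics)
    qed
    show "y = y'"
      if "x \<in> univ M" "z \<in> univ M" "y \<in> univ M" "y' \<in> univ M"
        "rint M e [x, z, y]" "rint M e [x, z, y']" for x z y y'
    proof -
      have "sat M (All 0 (All 1 (All 2 (All 3 (imp (E (Var 0) (Var 1) (Var 2))
          (imp (E (Var 0) (Var 1) (Var 3)) (Eq (Var 2) (Var 3)))))))) (\<lambda>_. u)"
        by (rule transfer) (auto simp: well_formed semantics)
      then show ?thesis using that by (simp add: semantics)
    qed
    show "\<exists>z\<in>univ M. rint M l [z, fint M (init_rep \<kappa> \<alpha>) []] \<and> rint M e [fint M \<alpha> [], z, x]"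
      if "x \<in> univ M" "\<alpha> \<in> Field \<kappa>" "rint M l [x, fint M \<alpha> []]" for x \<alpha>
    proof -
      have "sat M (All 0 (imp (lt (Var 0) (c \<alpha>))
          (Ex 1 (conj2 (lt (Var 1) (c (init_rep \<kappa> \<alpha>))) (E (c \<alpha>) (Var 1) (Var 0)))))) (\<lambda>_. u)"
      proof (rule transfer)
        have "\<exists>z\<in>Field \<kappa>. z \<in> underS \<kappa> (init_rep \<kappa> \<alpha>) \<and> y = enum_below \<kappa> \<alpha> z"
          if "y \<in> underS \<kappa> \<alpha>" for y
          using enum_below[OF wo \<open>\<alpha> \<in> Field \<kappa>\<close>] that uF unfolding bij_betw_def by blast
        then show "sat (?N D) (All 0 (imp (lt (Var 0) (c \<alpha>))
            (Ex 1 (conj2 (lt (Var 1) (c (init_rep \<kappa> \<alpha>))) (E (c \<alpha>) (Var 1) (Var 0)))))) v" for D v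
          by (auto simp: semantics)
      qed (use that rF in \<open>auto simp: well_formed\<close>)
      then show ?thesis using that by (simp add: semantics)
    qed
    show "\<exists>\<eta>\<in>Field \<kappa>. rint M e [fint M \<alpha> [], fint M \<xi> [], fint M \<eta> []]"
      if "\<alpha> \<in> Field \<kappa>" "\<xi> \<in> underS \<kappa> (init_rep \<kappa> \<alpha>)" for \<alpha> \<xi>
    proof
      let ?\<eta> = "enum_below \<kappa> \<alpha> \<xi>"
      show F: "?\<eta> \<in> Field \<kappa>"
        using enum_below[OF wo that(1)] that(2) uF unfolding bij_betw_def by blast
      have "sat M (E (c \<alpha>) (c \<xi>) (c ?\<eta>)) (\<lambda>_. u)"
        by (rule transfer) (use that F uF in \<open>auto simp: well_formed semantics\<close>)
      then show "rint M e [fint M \<alpha> [], fint M \<xi> [], fint M ?\<eta> []]" by (simp add: semantics)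
    qed
    show "\<exists>b\<in>initials \<kappa>. (rint M l [x, fint M \<alpha> []] \<longrightarrow> rint M l [fint M b [], fint M \<alpha> []]) \<and>
        (\<forall>y\<in>univ M. rint M l [y, x] \<longrightarrow>
          (\<exists>z\<in>univ M. rint M l [z, fint M b []] \<and> rint M e [x, z, y]))"
      if "x \<in> univ M" "\<alpha> \<in> Field \<kappa>" for x \<alpha>
    proof -
      let ?cov = "\<lambda>b. conj2 (imp (lt (Var 0) (c \<alpha>)) (lt (c b) (c \<alpha>)))
        (All 1 (imp (lt (Var 1) (Var 0)) (Ex 2 (conj2 (lt (Var 2) (c b)) (E (Var 0) (Var 2) (Var 1))))))"
      have "sat M (All 0 (big_disj (initials \<kappa>) ?cov)) (\<lambda>_. u)"
      proof (rule transfer)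
        have "\<exists>b\<in>initials \<kappa>. (y \<in> underS \<kappa> \<alpha> \<longrightarrow> b \<in> underS \<kappa> \<alpha>) \<and>
            (\<forall>w\<in>Field \<kappa>. w \<in> underS \<kappa> y \<longrightarrow> (\<exists>z\<in>Field \<kappa>. z \<in> underS \<kappa> b \<and>
              z \<in> underS \<kappa> (init_rep \<kappa> y) \<and> w = enum_below \<kappa> y z))"
          if y: "y \<in> Field \<kappa>" for y
        proof (rule bexI[of _ "init_rep \<kappa> y"], intro conjI impI ballI)
          show "init_rep \<kappa> y \<in> initials \<kappa>" using y by (simp add: initials_def)
          show "init_rep \<kappa> y \<in> underS \<kappa> \<alpha>" if "y \<in> underS \<kappa> \<alpha>"
            using init_rep(3)[OF wo y] that wo
            by (auto simp: underS_def order_on_defs dest: transD antisymD)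
          show "\<exists>z\<in>Field \<kappa>. z \<in> underS \<kappa> (init_rep \<kappa> y) \<and>
              z \<in> underS \<kappa> (init_rep \<kappa> y) \<and> w = enum_below \<kappa> y z" if "w \<in> underS \<kappa> y" for w
            using enum_below[OF wo y] that uF unfolding bij_betw_def by blast
        qed
        then show "sat (?N D) (All 0 (big_disj (initials \<kappa>) ?cov)) v" for D v
          by (simp add: semantics)
        have "(\<Union>b\<in>initials \<kappa>. free_vars (?cov b)) \<subseteq> {0}" by (auto simp: well_formed)
        moreover from this have "finite (\<Union>b\<in>initials \<kappa>. free_vars (?cov b))"
          by (rule finite_subset) simp
        moreover have "is_formula \<delta> ?L (?cov b)" if "b \<in> initials \<kappa>" for b
          using that iF \<open>\<alpha> \<in> Field \<kappa>\<close> by (auto simp: well_formed)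
        ultimately show "All 0 (big_disj (initials \<kappa>) ?cov) \<in> sentences \<delta> ?L"
          by (simp add: sentences_def big_disj[OF few])
      qed
      then show ?thesis using that by (simp add: semantics)
    qed
  qed
qed

section \<open>The bound\<close>

theorem theorem2:
  fixes \<delta> :: "'d rel" and \<kappa> :: "'k rel"
  assumes "Card_order \<delta>" and "Card_order \<kappa>"
    and "\<delta> \<le>o \<kappa>"
    and "regularCard \<delta>" and "natLeq <o \<delta>"
    and "compact_card \<delta> \<kappa> \<kappa>"
  shows "\<exists>c :: 'k rel. is_aleph \<delta> c \<and> c \<le>o \<kappa>"
proof -
  have wo: "Well_order \<kappa>" "Well_order \<delta>"
    using assms(1,2) by (auto intro: card_order_on_well_order_on)
  have "natLeq \<le>o |Field \<kappa>|"
    using assms(3,5) card_of_Field_ordIso[OF assms(2)] ordIso_symmetric ordLess_ordLeq_trans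
      ordLess_imp_ordLeq ordLeq_ordIso_trans by blast
  then have inf: "infinite (Field \<kappa>)" using infinite_iff_natLeq_ordLeq by blast
  show ?thesis
  proof (cases "\<delta> \<le>o Restr \<kappa> (infinite_cards_below \<kappa>)")
    case True
    then show ?thesis by (rule aleph_exists[OF assms(2) inf])
  next
    case False
    have "infinite_cards_below \<kappa> \<subseteq> Field \<kappa>" by (auto simp: infinite_cards_below_def)
    then have "Restr \<kappa> (infinite_cards_below \<kappa>) <o \<delta>"
      using False wo Well_order_Restr not_ordLeq_iff_ordLess by blast
    then have few: "|initials \<kappa>| <o \<delta>"
      by (rule card_initials_less[OF wo(1) assms(1,5)])
    \<comment> \<open>Relation symbols are kept apart from function symbols, so elements of \<open>\<kappa>\<close> can name both.\<close>
    obtain S where S: "card S = 3" "S \<subseteq> Field \<kappa>"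
      using infinite_arbitrarily_large[OF inf, of 3] by blast
    obtain l e d where led: "S = {l, e, d}" and dist: "l \<noteq> e" "l \<noteq> d" "e \<noteq> d"
      using S(1) unfolding card_3_iff by blast
    let ?L = "card_lang \<kappa> l e d" and ?N = "card_struct \<kappa> l e"
    have infU: "infinite (UNIV :: 'k set)" by (rule infinite_super[OF subset_UNIV inf])
    have \<kappa>F: "\<kappa> =o |Field \<kappa>|"
      using card_of_Field_ordIso[OF assms(2)] ordIso_symmetric by blast
    then have \<kappa>: "\<kappa> \<le>o |Field \<kappa>|" "|Field \<kappa>| \<le>o \<kappa>"
      using ordIso_iff_ordLeq by blast+
    have \<kappa>U: "\<delta> \<le>o |UNIV :: 'k set|"
      using assms(3) \<kappa>(1) card_of_mono1[of "Field \<kappa>" UNIV] ordLeq_transitive by blast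
    have "symbols ?L \<subseteq> Inl ` Field \<kappa> \<union> Inr ` Field \<kappa>"
      using led S(2) by (auto simp: symbols_def card_lang_def)
    then have "|symbols ?L| \<le>o |Inl ` Field \<kappa> \<union> Inr ` Field \<kappa> :: ('k + 'k) set|"
      by (rule card_of_mono1)
    also have "|Inl ` Field \<kappa> \<union> Inr ` Field \<kappa> :: ('k + 'k) set| \<le>o |Field \<kappa>|"
      by (intro card_Un_le[OF inf] card_of_image)
    also note \<kappa>(2)
    finally have L: "|symbols ?L| \<le>o \<kappa>" .
    have "is_structure ?L ?N"
      using inf by (auto simp: is_structure_def card_lang_def card_struct_def)
    then obtain M :: "('k, 'k set) struct" and x
      where M: "is_model ?L (robust_theory \<delta> ?L d ?N) M"
        and x: "x \<in> univ M" "\<And>\<alpha>. \<alpha> \<in> Field \<kappa> \<Longrightarrow> x \<noteq> fint M \<alpha> []"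
      by (rule compact_new_element[OF assms(6) L infU \<kappa>U, where A = "Field \<kappa>" and d = d])
        (use dist \<kappa>(1) in \<open>auto simp: card_lang_def card_struct_def\<close>)
    have "x \<in> (\<lambda>\<alpha>. fint M \<alpha> []) ` Field \<kappa>"
      using model_is_standard[OF assms(2) inf assms(5) few dist M] x(1) by blast
    then show ?thesis using x(2) by blast
  qed
qed

end
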